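(* If $X$ is a quasi-Polish space, then $\mathbf{K}(\mathbf{O}(X))$ with the upper Vietoris topology is homeomorphic to $\mathbf{O}(\mathbf{A}(X))$ with the Scott topology, via the map $\gamma\colon\mathbf{K}(\mathbf{O}(X))\to\mathbf{O}(\mathbf{A}(X))$ and its inverse $\delta\colon\mathbf{O}(\mathbf{A}(X))\to\mathbf{K}(\mathbf{O}(X))$.
   Context: A subset $A$ of a topological space $Y$ is a $\mathbf{\Pi}^0_2$-subset if there are sequences $(U_i)_{i\in\omega}$ and $(V_i)_{i\in\omega}$ of open subsets of $Y$ such that $x\in A$ if and only if for all $i\in\omega$, $x\in U_i$ implies $x\in V_i$. A topological space is quasi-Polish if it is countably based and its topology is induced by a Smyth-complete quasi-metric; equivalently, if it is homeomorphic to a $\mathbf{\Pi}^0_2$-subset of an $\omega$-algebraic domain with the Scott topology (one may always take the domain to be $\mathcal{P}(\omega)$, the powerset of $\omega$ ordered by inclusion, with the Scott topology). For a topological space $Y$: $\mathbf{A}(Y)$ is the set of all closed subsets of $Y$ with the lower Vietoris topology, generated by the sets $\Diamond U=\{A\in\mathbf{A}(Y)\mid A\cap U\neq\emptyset\}$ for $U\subseteq Y$ open. $\mathbf{K}(Y)$ is the set of all compact saturated subsets of $Y$ with the upper Vietoris topology, generated by the sets $\Box U=\{K\in\mathbf{K}(Y)\mid K\subseteq U\}$ for $U\subseteq Y$ open. (Compact: every open cover has a finite subcover. Saturated: equal to the intersection of all its open neighborhoods.) $\mathbf{O}(Y)$ is the lattice of open subsets of $Y$ ordered by inclusion and equipped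 with the Scott topology. The maps (which are well-defined for quasi-Polish $X$) are $$\gamma(\mathfrak{K})=\bigcap_{U\in\mathfrak{K}}\Diamond U,\qquad \delta(\mathcal{U})=\{U\in\mathbf{O}(X)\mid\mathcal{U}\subseteq\Diamond U\}$$ for $\mathfrak{K}\in\mathbf{K}(\mathbf{O}(X))$ and $\mathcal{U}\in\mathbf{O}(\mathbf{A}(X))$, where the empty intersection is $\mathbf{A}(X)$. *)

theory Defs
  imports "HOL-Analysis.Analysis"
begin

definition quasi_metric_on :: "'a set \<Rightarrow> ('a \<Rightarrow> 'a \<Rightarrow> real) \<Rightarrow> bool" where
  "quasi_metric_on S d \<longleftrightarrow>
     (\<forall>x\<in>S. \<forall>y\<in>S. 0 \<le> d x y) \<and>
     (\<forall>x\<in>S. \<forall>y\<in>S. x = y \<longleftrightarrow> d x y = 0 \<and> d y x = 0) \<and>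
     (\<forall>x\<in>S. \<forall>y\<in>S. \<forall>z\<in>S. d x z \<le> d x y + d y z)"

definition quasi_metric_ball :: "'a set \<Rightarrow> ('a \<Rightarrow> 'a \<Rightarrow> real) \<Rightarrow> 'a \<Rightarrow> real \<Rightarrow> 'a set" where
  "quasi_metric_ball S d x e = {y \<in> S. d x y < e}"

definition quasi_metric_topology :: "'a set \<Rightarrow> ('a \<Rightarrow> 'a \<Rightarrow> real) \<Rightarrow> 'a topology" where
  "quasi_metric_topology S d =
     topology (\<lambda>U. U \<subseteq> S \<and> (\<forall>x\<in>U. \<exists>e>0. quasi_metric_ball S d x e \<subseteq> U))"

lemma istopology_quasi_metric:
  "istopology (\<lambda>U. U \<subseteq> S \<and> (\<forall>x\<in>U. \<exists>e>0. quasi_metric_ball S d x e \<subseteq> U))"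
  (is "istopology ?P")
  unfolding istopology_def
proof (rule conjI; intro allI impI)
  fix U V assume UV: "?P U" "?P V"
  have "\<exists>e>0. quasi_metric_ball S d x e \<subseteq> U \<inter> V" if x: "x \<in> U \<inter> V" for x
  proof -
    obtain e f where "e > 0" "quasi_metric_ball S d x e \<subseteq> U"
      "f > 0" "quasi_metric_ball S d x f \<subseteq> V"
      using UV x by blast
    then show ?thesis
      by (intro exI[of _ "min e f"]) (auto simp: quasi_metric_ball_def)
  qed
  then show "?P (U \<inter> V)"
    using UV by blast
next
  fix \<K> assume \<K>: "\<forall>K\<in>\<K>. ?P K"
  have "\<exists>e>0. quasi_metric_ball S d x e \<subseteq> \<Union>\<K>" if x: "x \<in> \<Union>\<K>" for x
  proof -
    obtain K where K: "K \<in> \<K>" "x \<in> K"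
      using x by blast
    then obtain e where "e > 0" "quasi_metric_ball S d x e \<subseteq> K"
      using \<K> by blast
    then show ?thesis
      using K(1) by blast
  qed
  then show "?P (\<Union>\<K>)"
    using \<K> by blast
qed

lemma openin_quasi_metric_topology:
  "openin (quasi_metric_topology S d) U \<longleftrightarrow>
     U \<subseteq> S \<and> (\<forall>x\<in>U. \<exists>e>0. quasi_metric_ball S d x e \<subseteq> U)"
  by (simp add: quasi_metric_topology_def topology_inverse'[OF istopology_quasi_metric])

definition quasi_metric_Cauchy :: "('a \<Rightarrow> 'a \<Rightarrow> real) \<Rightarrow> (nat \<Rightarrow> 'a) \<Rightarrow> bool" where
  "quasi_metric_Cauchy d \<sigma> \<longleftrightarrow> (\<forall>e>0. \<exists>N. \<forall>n\<ge>N. \<forall>m\<ge>n. d (\<sigma> n) (\<sigma> m) < e)"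

text \<open>Smyth-completeness asks for convergence in the topology of the symmetrised metric,
  not merely in the topology of the quasi-metric itself.\<close>

definition Smyth_complete :: "'a set \<Rightarrow> ('a \<Rightarrow> 'a \<Rightarrow> real) \<Rightarrow> bool" where
  "Smyth_complete S d \<longleftrightarrow>
     (\<forall>\<sigma>. range \<sigma> \<subseteq> S \<and> quasi_metric_Cauchy d \<sigma> \<longrightarrow>
        (\<exists>l. limitin (quasi_metric_topology S (\<lambda>x y. max (d x y) (d y x))) \<sigma> l sequentially))"

definition quasi_Polish :: "'a topology \<Rightarrow> bool" where
  "quasi_Polish X \<longleftrightarrow> second_countable X \<and>
     (\<exists>d. quasi_metric_on (topspace X) d \<and> Smyth_complete (topspace X) d \<and>
          X = quasi_metric_topology (topspace X) d)"

definition directed_set :: "'a::order set \<Rightarrow> bool" where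
  "directed_set D \<longleftrightarrow> D \<noteq> {} \<and> (\<forall>x\<in>D. \<forall>y\<in>D. \<exists>z\<in>D. x \<le> z \<and> y \<le> z)"

definition lub_in :: "'a::order set \<Rightarrow> 'a set \<Rightarrow> 'a \<Rightarrow> bool" where
  "lub_in L D s \<longleftrightarrow>
     s \<in> L \<and> (\<forall>x\<in>D. x \<le> s) \<and> (\<forall>u\<in>L. (\<forall>x\<in>D. x \<le> u) \<longrightarrow> s \<le> u)"

definition Scott_open_in :: "'a::order set \<Rightarrow> 'a set \<Rightarrow> bool" where
  "Scott_open_in L W \<longleftrightarrow> W \<subseteq> L \<and>
     (\<forall>x\<in>W. \<forall>y\<in>L. x \<le> y \<longrightarrow> y \<in> W) \<and>
     (\<forall>D s. D \<subseteq> L \<and> directed_set D \<and> lub_in L D s \<and> s \<in> W \<longrightarrow> D \<inter> W \<noteq> {})"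

lemma Scott_open_inD:
  assumes "Scott_open_in L W"
  shows "W \<subseteq> L"
    and "\<And>x y. x \<in> W \<Longrightarrow> y \<in> L \<Longrightarrow> x \<le> y \<Longrightarrow> y \<in> W"
    and "\<And>D s. D \<subseteq> L \<Longrightarrow> directed_set D \<Longrightarrow> lub_in L D s \<Longrightarrow> s \<in> W \<Longrightarrow> \<exists>x. x \<in> D \<and> x \<in> W"
  using assms unfolding Scott_open_in_def disjoint_iff by (simp, metis, metis)

lemma Scott_open_inI:
  assumes "W \<subseteq> L"
    and "\<And>x y. x \<in> W \<Longrightarrow> y \<in> L \<Longrightarrow> x \<le> y \<Longrightarrow> y \<in> W"
    and "\<And>D s. D \<subseteq> L \<Longrightarrow> directed_set D \<Longrightarrow> lub_in L D s \<Longrightarrow> s \<in> W \<Longrightarrow> \<exists>x. x \<in> D \<and> x \<in> W"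
  shows "Scott_open_in L W"
  unfolding Scott_open_in_def disjoint_iff
  by (intro conjI ballI allI impI; (elim conjE)?) (use assms in \<open>simp; metis\<close>)+

definition Scott_topology :: "'a::order set \<Rightarrow> 'a topology" where
  "Scott_topology L = topology (Scott_open_in L)"

lemma istopology_Scott_open_in: "istopology (Scott_open_in L)"
  unfolding istopology_def
proof (intro conjI allI impI)
  fix U V assume U: "Scott_open_in L U" and V: "Scott_open_in L V"
  show "Scott_open_in L (U \<inter> V)"
  proof (rule Scott_open_inI)
    show "U \<inter> V \<subseteq> L"
      using Scott_open_inD(1)[OF U] by blast
  next
    fix x y assume "x \<in> U \<inter> V" "y \<in> L" "x \<le> y"
    then show "y \<in> U \<inter> V"
      using Scott_open_inD(2)[OF U, of x y] Scott_open_inD(2)[OF V, of x y] by simp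
  next
    fix D s assume D: "D \<subseteq> L" "directed_set D" "lub_in L D s" "s \<in> U \<inter> V"
    obtain x where x: "x \<in> D" "x \<in> U"
      using Scott_open_inD(3)[OF U D(1-3)] D(4) by blast
    obtain y where y: "y \<in> D" "y \<in> V"
      using Scott_open_inD(3)[OF V D(1-3)] D(4) by blast
    obtain z where z: "z \<in> D" "x \<le> z" "y \<le> z"
      using D(2) x(1) y(1) unfolding directed_set_def by blast
    have "z \<in> L"
      using z(1) D(1) by (rule subsetD[rotated])
    then have "z \<in> U \<inter> V"
      using Scott_open_inD(2)[OF U x(2) _ z(2)] Scott_open_inD(2)[OF V y(2) _ z(3)] by simp
    then show "\<exists>x. x \<in> D \<and> x \<in> U \<inter> V"
      using z(1) by (intro exI[of _ z]) simp
  qed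
next
  fix \<K> assume \<K>: "\<forall>K\<in>\<K>. Scott_open_in L K"
  show "Scott_open_in L (\<Union>\<K>)"
  proof (rule Scott_open_inI)
    show "\<Union>\<K> \<subseteq> L"
      using \<K> by (intro Union_least Scott_open_inD(1)) simp
  next
    fix x y assume xy: "x \<in> \<Union>\<K>" "y \<in> L" "x \<le> y"
    then obtain K where K: "K \<in> \<K>" "x \<in> K"
      by (elim UnionE)
    have "y \<in> K"
      using \<K> K by (intro Scott_open_inD(2)[OF _ K(2) xy(2,3)]) simp
    then show "y \<in> \<Union>\<K>"
      using K(1) by (rule UnionI[rotated])
  next
    fix D s assume D: "D \<subseteq> L" "directed_set D" "lub_in L D s" "s \<in> \<Union>\<K>"
    then obtain K where K: "K \<in> \<K>" "s \<in> K"
      by (elim UnionE)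
    then have "\<exists>x. x \<in> D \<and> x \<in> K"
      using \<K> by (intro Scott_open_inD(3)[OF _ D(1-3) K(2)]) simp
    then show "\<exists>x. x \<in> D \<and> x \<in> \<Union>\<K>"
      using K(1) by (elim exE conjE) (intro exI conjI UnionI)
  qed
qed

lemma openin_Scott_topology: "openin (Scott_topology L) W \<longleftrightarrow> Scott_open_in L W"
  by (simp add: Scott_topology_def topology_inverse'[OF istopology_Scott_open_in])

lemma topspace_Scott_topology [simp]: "topspace (Scott_topology L) = L"
proof (rule antisym)
  show "topspace (Scott_topology L) \<subseteq> L"
    using openin_topspace[of "Scott_topology L"]
    unfolding openin_Scott_topology by (rule Scott_open_inD(1))
  have "Scott_open_in L L"
    by (rule Scott_open_inI) (auto simp: directed_set_def)
  then show "L \<subseteq> topspace (Scott_topology L)"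
    by (intro openin_subset) (simp add: openin_Scott_topology)
qed

definition opens_space :: "'a topology \<Rightarrow> 'a set topology" where
  "opens_space Y = Scott_topology {U. openin Y U}"

definition diamond :: "'a topology \<Rightarrow> 'a set \<Rightarrow> 'a set set" where
  "diamond Y U = {A. closedin Y A \<and> A \<inter> U \<noteq> {}}"

text \<open>The carrier has to be given explicitly: the empty closed set lies in no
  set \<^term>\<open>diamond Y U\<close>.\<close>

definition closeds_space :: "'a topology \<Rightarrow> 'a set topology" where
  "closeds_space Y =
     topology (arbitrary union_of
       (finite intersection_of (\<lambda>W. \<exists>U. openin Y U \<and> W = diamond Y U)
         relative_to {A. closedin Y A}))"

definition saturatedin :: "'a topology \<Rightarrow> 'a set \<Rightarrow> bool" where
  "saturatedin Y K \<longleftrightarrow> K = \<Inter> {U. openin Y U \<and> K \<subseteq> U}"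

definition compact_saturated :: "'a topology \<Rightarrow> 'a set set" where
  "compact_saturated Y = {K. compactin Y K \<and> saturatedin Y K}"

definition box_set :: "'a topology \<Rightarrow> 'a set \<Rightarrow> 'a set set" where
  "box_set Y U = {K \<in> compact_saturated Y. K \<subseteq> U}"

definition compacts_space :: "'a topology \<Rightarrow> 'a set topology" where
  "compacts_space Y =
     topology (arbitrary union_of
       (finite intersection_of (\<lambda>W. \<exists>U. openin Y U \<and> W = box_set Y U)
         relative_to compact_saturated Y))"

definition gamma_map :: "'a topology \<Rightarrow> 'a set set \<Rightarrow> 'a set set" where
  "gamma_map X \<KK> = {A. closedin X A} \<inter> (\<Inter>U\<in>\<KK>. diamond X U)"

definition delta_map :: "'a topology \<Rightarrow> 'a set set \<Rightarrow> 'a set set" where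
  "delta_map X \<U> = {U. openin X U \<and> \<U> \<subseteq> diamond X U}"

end

theory Submission
  imports Defs
begin

text \<open>That the two maps are mutually inverse only needs complements of open and closed sets.
  Openness of \<open>gamma_map X \<KK>\<close> follows from countability: a sequence of closed sets converging to
  a member \<open>A\<close> forms, together with \<open>A\<close>, a compact set, and the open sets meeting all members of
  a compact set are Scott open. A basic open set of closed sets is mapped by \<open>delta_map\<close> to the upper
  set generated by finitely many open sets; a compactness argument on choice functions then gives
  compactness of \<open>delta_map X \<U>\<close> and continuity of \<open>delta_map\<close>. Continuity of \<open>gamma_map\<close> rests
  on consonance of the space of closed sets: below a member of a Scott open family one can choose
  finite unions of basic sets, given by ever smaller balls of a Smyth-complete quasi-metric, that
  remain in the family; Smyth completeness and a Koenig argument show that their intersection \<open>\<K>\<close> is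
  compact and that every open neighbourhood of \<open>\<K>\<close> is in the family.\<close>

section \<open>Directed sets and Scott open families of open sets\<close>

lemma directed_set_finite_upper_bound:
  assumes "directed_set D" "finite F" "F \<subseteq> D"
  shows "\<exists>z\<in>D. \<forall>x\<in>F. x \<le> z"
  using assms(2,3)
proof (induction F rule: finite_induct)
  case empty
  then show ?case using assms(1) unfolding directed_set_def by blast
next
  case (insert x F)
  then obtain z where z: "z \<in> D" "\<forall>x\<in>F. x \<le> z" by blast
  moreover obtain w where "w \<in> D" "x \<le> w" "z \<le> w"
    using assms(1) insert.prems z(1) unfolding directed_set_def by blast
  ultimately show ?case by (intro bexI[of _ w]) (auto intro: order_trans)
qed

lemma lub_in_opens:
  assumes "D \<subseteq> {U. openin Y U}" "lub_in {U. openin Y U} D s"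
  shows "s = \<Union>D"
proof (rule antisym)
  have "openin Y (\<Union>D)" using assms(1) by blast
  then show "s \<subseteq> \<Union>D" using assms(2) unfolding lub_in_def by blast
  show "\<Union>D \<subseteq> s" using assms(2) unfolding lub_in_def by blast
qed

lemma lub_in_opens_Union:
  assumes "D \<subseteq> {U. openin Y U}"
  shows "lub_in {U. openin Y U} D (\<Union>D)"
  using assms unfolding lub_in_def by blast

lemma Scott_open_in_opensI:
  assumes "\<And>U. U \<in> W \<Longrightarrow> openin Y U"
    and "\<And>U V. U \<in> W \<Longrightarrow> openin Y V \<Longrightarrow> U \<subseteq> V \<Longrightarrow> V \<in> W"
    and "\<And>D. (\<And>U. U \<in> D \<Longrightarrow> openin Y U) \<Longrightarrow> directed_set D \<Longrightarrow> \<Union>D \<in> W \<Longrightarrow> \<exists>U\<in>D. U \<in> W"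
  shows "Scott_open_in {U. openin Y U} W"
proof (rule Scott_open_inI)
  fix D s assume D: "D \<subseteq> {U. openin Y U}" "directed_set D" "lub_in {U. openin Y U} D s" "s \<in> W"
  then have "s = \<Union>D" using lub_in_opens by blast
  with D assms(3)[of D] show "\<exists>U. U \<in> D \<and> U \<in> W" by blast
next
  show "W \<subseteq> {U. openin Y U}" using assms(1) by blast
  show "\<And>x y. x \<in> W \<Longrightarrow> y \<in> {U. openin Y U} \<Longrightarrow> x \<subseteq> y \<Longrightarrow> y \<in> W"
    using assms(2) by simp
qed

text \<open>The unions of finite subfamilies of \<open>C\<close> form a directed family with
  supremum \<open>\<Union>C\<close>, so Scott openness selects one of them. The empty subfamily
  keeps this family nonempty even for \<open>C = {}\<close>.\<close>

lemma Scott_open_in_finite_subfamily: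
  assumes W: "Scott_open_in {U. openin Y U} W"
    and C: "\<And>U. U \<in> C \<Longrightarrow> openin Y U" and CW: "\<Union>C \<in> W"
  shows "\<exists>C'. finite C' \<and> C' \<subseteq> C \<and> \<Union>C' \<in> W"
proof -
  define D where "D = {\<Union>C' | C'. finite C' \<and> C' \<subseteq> C}"
  have sub: "D \<subseteq> {U. openin Y U}" using C unfolding D_def by blast
  have "directed_set D"
    unfolding directed_set_def
  proof (intro conjI ballI)
    show "D \<noteq> {}" unfolding D_def by blast
    fix x y assume "x \<in> D" "y \<in> D"
    then obtain A B where "x = \<Union>A" "y = \<Union>B" "finite A" "finite B" "A \<subseteq> C" "B \<subseteq> C"
      unfolding D_def by blast
    moreover from this have "\<Union>(A \<union> B) \<in> D" unfolding D_def by blast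
    ultimately show "\<exists>z\<in>D. x \<le> z \<and> y \<le> z"
      by (intro bexI[of _ "\<Union>(A \<union> B)"]) auto
  qed
  moreover have "\<Union>D = \<Union>C"
  proof
    show "\<Union>D \<subseteq> \<Union>C" unfolding D_def by blast
    have "U \<in> D" if "U \<in> C" for U
      unfolding D_def using that by (intro CollectI exI[of _ "{U}"]) simp
    then show "\<Union>C \<subseteq> \<Union>D" by blast
  qed
  ultimately obtain U where "U \<in> D" "U \<in> W"
    using Scott_open_inD(3)[OF W sub _ lub_in_opens_Union[OF sub]] CW by metis
  then show ?thesis unfolding D_def by blast
qed

text \<open>A union meets \<open>A\<close> only if one of its members does. These Scott open
  families later exhibit \<open>delta_map X \<U>\<close> as an intersection of open sets.\<close>

lemma Scott_open_in_meeting: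
  "Scott_open_in {U. openin X U} {U. openin X U \<and> A \<inter> U \<noteq> {}}"
proof (rule Scott_open_in_opensI)
  fix D assume "\<And>U. U \<in> D \<Longrightarrow> openin X U" "\<Union>D \<in> {U. openin X U \<and> A \<inter> U \<noteq> {}}"
  then show "\<exists>U\<in>D. U \<in> {U. openin X U \<and> A \<inter> U \<noteq> {}}" by blast
qed auto

text \<open>A saturated set is an intersection of Scott open families, each of which is upward
  closed.\<close>

lemma saturatedin_opens_space_upward:
  assumes "saturatedin (opens_space X) K" "U \<in> K" "openin X V" "U \<subseteq> V"
  shows "V \<in> K"
proof -
  have "V \<in> W" if "openin (opens_space X) W" "K \<subseteq> W" for W
    using that assms Scott_open_inD(2)[of _ W U V]
    unfolding opens_space_def openin_Scott_topology by blast
  then show ?thesis using assms(1) unfolding saturatedin_def by blast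
qed

section \<open>Bases of the Vietoris topologies\<close>

text \<open>For finite \<open>F\<close> of open sets these are the basic open sets of the lower
  Vietoris topology. Closedness is a separate conjunct so that \<open>F = {}\<close> gives the whole
  carrier, including the empty closed set.\<close>

definition diamonds :: "'a topology \<Rightarrow> 'a set set \<Rightarrow> 'a set set" where
  "diamonds X F = {A. closedin X A \<and> (\<forall>U\<in>F. A \<inter> U \<noteq> {})}"

lemma diamonds_subset_closed: "diamonds X F \<subseteq> {A. closedin X A}"
  unfolding diamonds_def by blast

lemma diamonds_finite_intersection:
  "(finite intersection_of (\<lambda>W. \<exists>U. openin X U \<and> W = diamond X U)
     relative_to {A. closedin X A}) W \<longleftrightarrow>
   (\<exists>F. finite F \<and> (\<forall>U\<in>F. openin X U) \<and> W = diamonds X F)" (is "?L \<longleftrightarrow> ?R")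
proof
  assume ?L
  then obtain \<T> where \<T>: "finite \<T>" "\<forall>T\<in>\<T>. \<exists>U. openin X U \<and> T = diamond X U"
    "W = {A. closedin X A} \<inter> \<Inter>\<T>"
    unfolding relative_to_def intersection_of_def by auto
  then obtain f where f: "\<forall>T\<in>\<T>. openin X (f T) \<and> T = diamond X (f T)" by metis
  have "A \<in> T \<longleftrightarrow> A \<inter> f T \<noteq> {}" if "closedin X A" "T \<in> \<T>" for A T
    using that f unfolding diamond_def by blast
  then have "W = diamonds X (f ` \<T>)"
    unfolding \<T>(3) diamonds_def by auto
  then show ?R using \<T>(1) f by (intro exI[of _ "f ` \<T>"]) simp
next
  assume ?R
  then obtain F where "finite F" "\<forall>U\<in>F. openin X U" "W = diamonds X F" by blast
  then show ?L
    unfolding relative_to_def intersection_of_def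
    by (intro exI[of _ "\<Inter>(diamond X ` F)"] conjI exI[of _ "diamond X ` F"])
       (auto simp: diamonds_def diamond_def)
qed

lemma openin_closeds_space:
  "openin (closeds_space X) \<U> \<longleftrightarrow>
     (\<forall>A\<in>\<U>. \<exists>F. finite F \<and> (\<forall>U\<in>F. openin X U) \<and> A \<in> diamonds X F \<and> diamonds X F \<subseteq> \<U>)"
proof -
  have "openin (closeds_space X) \<U> \<longleftrightarrow>
     (arbitrary union_of (finite intersection_of (\<lambda>W. \<exists>U. openin X U \<and> W = diamond X U)
         relative_to {A. closedin X A})) \<U>"
    unfolding closeds_space_def by (subst topology_inverse'[OF istopology_subbase]) (rule refl)
  also have "\<dots> \<longleftrightarrow> (\<forall>A\<in>\<U>. \<exists>F. finite F \<and> (\<forall>U\<in>F. openin X U) \<and> A \<in> diamonds X F \<and> diamonds X F \<subseteq> \<U>)"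
    unfolding arbitrary_union_of_alt diamonds_finite_intersection by metis
  finally show ?thesis .
qed

lemma openin_closeds_space_diamonds:
  "finite F \<Longrightarrow> \<forall>U\<in>F. openin X U \<Longrightarrow> openin (closeds_space X) (diamonds X F)"
  unfolding openin_closeds_space by (intro ballI exI[of _ F]) simp

lemma openin_closeds_space_diamond:
  assumes "openin X U" shows "openin (closeds_space X) (diamond X U)"
proof -
  have "diamond X U = diamonds X {U}" unfolding diamond_def diamonds_def by auto
  with openin_closeds_space_diamonds[of "{U}" X] assms show ?thesis by simp
qed

lemma openin_closeds_space_closed:
  "openin (closeds_space X) \<U> \<Longrightarrow> A \<in> \<U> \<Longrightarrow> closedin X A"
  unfolding openin_closeds_space using diamonds_subset_closed by fastforce

text \<open>Enlarging a closed set preserves that it meets each member of \<open>F\<close>, so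
  already the basic open sets are upward closed.\<close>

lemma openin_closeds_space_upward:
  assumes "openin (closeds_space X) \<U>" "A \<in> \<U>" "closedin X B" "A \<subseteq> B"
  shows "B \<in> \<U>"
proof -
  obtain F where "A \<in> diamonds X F" "diamonds X F \<subseteq> \<U>"
    using assms(1,2) unfolding openin_closeds_space by blast
  then have "B \<in> diamonds X F" using assms(3,4) unfolding diamonds_def by fast
  then show ?thesis using \<open>diamonds X F \<subseteq> \<U>\<close> by blast
qed

text \<open>Lying in finitely many open sets is the same as lying in their open intersection, so the
  subbase of boxes is already a base.\<close>

lemma box_set_finite_intersection:
  "(finite intersection_of (\<lambda>W. \<exists>U. openin Y U \<and> W = box_set Y U)
     relative_to compact_saturated Y) \<W> \<longleftrightarrow> (\<exists>U. openin Y U \<and> \<W> = box_set Y U)" (is "?L \<longleftrightarrow> ?R")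
proof
  assume ?L
  then obtain \<T> where \<T>: "finite \<T>" "\<forall>T\<in>\<T>. \<exists>U. openin Y U \<and> T = box_set Y U"
    "\<W> = compact_saturated Y \<inter> \<Inter>\<T>"
    unfolding relative_to_def intersection_of_def by auto
  then obtain f where f: "\<forall>T\<in>\<T>. openin Y (f T) \<and> T = box_set Y (f T)" by metis
  \<comment> \<open>Inserting \<open>topspace Y\<close> makes \<open>U\<close> open even when
    \<open>\<T>\<close> is empty; compact sets lie in it anyway.\<close>
  define U where "U = \<Inter>(insert (topspace Y) (f ` \<T>))"
  have "openin Y U"
    unfolding U_def using \<T>(1) f by (intro openin_Inter) auto
  moreover have "\<W> = box_set Y U"
  proof -
    have "K \<subseteq> topspace Y" if "K \<in> compact_saturated Y" for K
      using that compactin_subset_topspace unfolding compact_saturated_def by blast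
    moreover have "K \<in> T \<longleftrightarrow> K \<subseteq> f T" if "K \<in> compact_saturated Y" "T \<in> \<T>" for K T
      using that f unfolding box_set_def by blast
    ultimately have "K \<in> \<W> \<longleftrightarrow> K \<subseteq> U" if "K \<in> compact_saturated Y" for K
      using that unfolding \<T>(3) U_def by (simp add: le_Inf_iff)
    then show ?thesis unfolding box_set_def using \<T>(3) by blast
  qed
  ultimately show ?R by blast
next
  assume ?R
  then obtain U where "openin Y U" "\<W> = box_set Y U" by blast
  then show ?L
    unfolding relative_to_def intersection_of_def
    by (intro exI[of _ "box_set Y U"] conjI exI[of _ "{box_set Y U}"]) (auto simp: box_set_def)
qed

lemma openin_compacts_space:
  "openin (compacts_space Y) \<W> \<longleftrightarrow>
     (\<forall>K\<in>\<W>. \<exists>U. openin Y U \<and> K \<in> box_set Y U \<and> box_set Y U \<subseteq> \<W>)"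
proof -
  have "openin (compacts_space Y) \<W> \<longleftrightarrow>
     (arbitrary union_of (finite intersection_of (\<lambda>W. \<exists>U. openin Y U \<and> W = box_set Y U)
         relative_to compact_saturated Y)) \<W>"
    unfolding compacts_space_def by (subst topology_inverse'[OF istopology_subbase]) (rule refl)
  also have "\<dots> \<longleftrightarrow> (\<forall>K\<in>\<W>. \<exists>U. openin Y U \<and> K \<in> box_set Y U \<and> box_set Y U \<subseteq> \<W>)"
    unfolding arbitrary_union_of_alt box_set_finite_intersection by metis
  finally show ?thesis .
qed

lemma openin_compacts_space_box_set:
  "openin Y U \<Longrightarrow> openin (compacts_space Y) (box_set Y U)"
  unfolding openin_compacts_space by (intro ballI exI[of _ U]) simp

lemma topspace_compacts_space: "topspace (compacts_space Y) = compact_saturated Y"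
proof
  show "topspace (compacts_space Y) \<subseteq> compact_saturated Y"
    using openin_topspace[of "compacts_space Y"]
    unfolding openin_compacts_space box_set_def by blast
  have "compact_saturated Y = box_set Y (topspace Y)"
    unfolding box_set_def compact_saturated_def by (auto dest: compactin_subset_topspace)
  then show "compact_saturated Y \<subseteq> topspace (compacts_space Y)"
    using openin_subset[OF openin_compacts_space_box_set[OF openin_topspace[of Y]]] by simp
qed

section \<open>The map gamma\<close>

lemma gamma_map_openin:
  assumes X: "second_countable X" and K: "compactin (opens_space X) \<KK>"
  shows "openin (closeds_space X) (gamma_map X \<KK>)"
proof (rule ccontr)
  assume "\<not> openin (closeds_space X) (gamma_map X \<KK>)"
  then obtain A where A: "A \<in> gamma_map X \<KK>"
    and noF: "\<And>F. finite F \<Longrightarrow> (\<forall>U\<in>F. openin X U) \<Longrightarrow> A \<in> diamonds X F \<Longrightarrow>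
       \<not> diamonds X F \<subseteq> gamma_map X \<KK>"
    unfolding openin_closeds_space by blast
  have KX: "openin X U" if "U \<in> \<KK>" for U
    using compactin_subset_topspace[OF K] that unfolding opens_space_def by auto
  have closedA: "closedin X A" and meetA: "\<And>U. U \<in> \<KK> \<Longrightarrow> A \<inter> U \<noteq> {}"
    using A unfolding gamma_map_def diamond_def by auto
  obtain \<B> where \<B>: "countable \<B>" "\<forall>V\<in>\<B>. openin X V"
    "\<And>U x. openin X U \<Longrightarrow> x \<in> U \<Longrightarrow> \<exists>V\<in>\<B>. x \<in> V \<and> V \<subseteq> U"
    using X unfolding second_countable_def by metis
  \<comment> \<open>\<open>{}\<close> is inserted so that the enumerated set is nonempty; as no set
    meets \<open>{}\<close>, it never enters \<open>F n\<close> below.\<close>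
  define b where "b = from_nat_into (insert {} \<B>)"
  have rb: "range b = insert {} \<B>"
    unfolding b_def using \<B>(1) by (intro range_from_nat_into) auto
  have ob: "openin X (b i)" for i
  proof -
    have "b i \<in> insert {} \<B>" using rb by blast
    then show ?thesis using \<B>(2) by auto
  qed
  \<comment> \<open>The sets \<open>diamonds X (F n)\<close> form a decreasing sequence of basic
    neighbourhoods of \<open>A\<close>. Picking from each a closed set \<open>B n\<close> outside
    \<open>gamma_map X \<KK>\<close> gives a sequence converging to \<open>A\<close>.\<close>
  define F where "F n = {b i | i. i \<le> n \<and> A \<inter> b i \<noteq> {}}" for n :: nat
  have "\<exists>B U. B \<in> diamonds X (F n) \<and> U \<in> \<KK> \<and> B \<inter> U = {}" for n
  proof -
    have "\<not> diamonds X (F n) \<subseteq> gamma_map X \<KK>"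
    proof (rule noF)
      show "finite (F n)" unfolding F_def by simp
      show "\<forall>U\<in>F n. openin X U" using ob unfolding F_def by blast
      show "A \<in> diamonds X (F n)" using closedA unfolding F_def diamonds_def by blast
    qed
    then show ?thesis unfolding gamma_map_def diamond_def diamonds_def by blast
  qed
  then obtain B V where B: "\<And>n. B n \<in> diamonds X (F n)"
    and V: "\<And>n. V n \<in> \<KK>" "\<And>n. B n \<inter> V n = {}" by metis
  have conv: "\<exists>N. \<forall>n\<ge>N. B n \<inter> U \<noteq> {}" if U: "openin X U" "A \<inter> U \<noteq> {}" for U
  proof -
    obtain x where "x \<in> A" "x \<in> U" using U(2) by blast
    then obtain C where "C \<in> \<B>" "x \<in> C" "C \<subseteq> U" using \<B>(3)[OF U(1)] by blast
    then obtain i where i: "A \<inter> b i \<noteq> {}" "b i \<subseteq> U" using rb \<open>x \<in> A\<close>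
      by (metis IntI empty_iff insertCI rangeE)
    have "B n \<inter> U \<noteq> {}" if "n \<ge> i" for n
    proof -
      have "b i \<in> F n" using i that unfolding F_def by blast
      then show ?thesis using B[of n] i(2) unfolding diamonds_def by blast
    qed
    then show ?thesis by blast
  qed
  \<comment> \<open>\<open>W N\<close> consists of the open sets meeting every member of the compact
    set formed by \<open>A\<close> and the tail of \<open>B\<close> from \<open>N\<close> on; hence
    it is Scott open.\<close>
  define W where "W N = {U. openin X U \<and> A \<inter> U \<noteq> {} \<and> (\<forall>n\<ge>N. B n \<inter> U \<noteq> {})}" for N :: nat
  have W: "openin (opens_space X) (W N)" for N
    unfolding opens_space_def openin_Scott_topology
  proof (rule Scott_open_in_opensI)
    fix D assume D: "\<And>U. U \<in> D \<Longrightarrow> openin X U" "directed_set D" "\<Union>D \<in> W N"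
    \<comment> \<open>A member of \<open>D\<close> meeting \<open>A\<close> meets all
      \<open>B n\<close> with \<open>n \<ge> M\<close>; the finitely many indices between
      \<open>N\<close> and \<open>M\<close> are treated one by one, and directedness gives a common
      upper bound.\<close>
    obtain U where U: "U \<in> D" "A \<inter> U \<noteq> {}" using D(3) unfolding W_def by blast
    obtain M where M: "\<forall>n\<ge>M. B n \<inter> U \<noteq> {}" using conv[OF D(1)[OF U(1)] U(2)] by blast
    have "\<forall>n\<in>{N..<M}. \<exists>U\<in>D. B n \<inter> U \<noteq> {}" using D(3) unfolding W_def by fastforce
    then obtain f where f: "\<forall>n\<in>{N..<M}. f n \<in> D \<and> B n \<inter> f n \<noteq> {}" by metis
    then obtain Z where Z: "Z \<in> D" "\<forall>U'\<in>insert U (f ` {N..<M}). U' \<subseteq> Z"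
      using directed_set_finite_upper_bound[OF D(2), of "insert U (f ` {N..<M})"] U(1) by blast
    have "B n \<inter> Z \<noteq> {}" if "n \<ge> N" for n
    proof (cases "n < M")
      case True
      then have "f n \<subseteq> Z" "B n \<inter> f n \<noteq> {}" using Z f that by auto
      then show ?thesis by blast
    next
      case False
      then show ?thesis using M Z(2) by (metis Int_mono insertI1 not_less order_refl subset_empty)
    qed
    then have "Z \<in> W N" using Z U D(1) unfolding W_def by blast
    then show "\<exists>U\<in>D. U \<in> W N" using Z(1) by blast
  next
    fix U V assume "U \<in> W N" "openin X V" "U \<subseteq> V"
    then show "V \<in> W N" unfolding W_def by blast
  qed (simp add: W_def)
  have "\<KK> \<subseteq> \<Union>(range W)"
  proof
    fix U assume "U \<in> \<KK>"
    then obtain N where "\<forall>n\<ge>N. B n \<inter> U \<noteq> {}" using conv[of U] KX meetA by meson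
    then have "U \<in> W N" using KX meetA \<open>U \<in> \<KK>\<close> unfolding W_def by simp
    then show "U \<in> \<Union>(range W)" by blast
  qed
  then obtain \<F> where \<F>: "finite \<F>" "\<F> \<subseteq> range W" "\<KK> \<subseteq> \<Union>\<F>"
    using compactinD[OF K, of "range W"] W by (metis rangeE)
  then obtain I where I: "finite I" "\<F> = W ` I" by (meson finite_subset_image)
  \<comment> \<open>\<open>N\<close> bounds all indices of the finite subcover. So
    \<open>V N\<close> lies in some \<open>W i\<close> with \<open>i \<le> N\<close> and therefore
    meets \<open>B N\<close>, contrary to the choice of \<open>V N\<close>.\<close>
  define N where "N = Max (insert 0 I)"
  have "V N \<in> \<Union>(W ` I)" using V(1) \<F>(3) I(2) by blast
  then obtain i where "i \<in> I" "V N \<in> W i" by blast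
  moreover have "i \<le> N" using I(1) \<open>i \<in> I\<close> unfolding N_def by simp
  ultimately show False using V(2)[of N] unfolding W_def by blast
qed

section \<open>The map delta\<close>

text \<open>If \<open>U\<close> includes no member of \<open>F\<close>, its complement is a closed
  set that meets every member of \<open>F\<close> but misses \<open>U\<close>; conversely, a set
  meeting some \<open>V \<subseteq> U\<close> meets \<open>U\<close>.\<close>

lemma delta_map_diamonds:
  assumes "\<And>F U. F \<in> C \<Longrightarrow> U \<in> F \<Longrightarrow> openin X U"
  shows "delta_map X (\<Union>F\<in>C. diamonds X F) = {U. openin X U \<and> (\<forall>F\<in>C. \<exists>V\<in>F. V \<subseteq> U)}"
proof (intro antisym subsetI)
  fix U assume U: "U \<in> delta_map X (\<Union>F\<in>C. diamonds X F)"
  have "\<exists>V\<in>F. V \<subseteq> U" if F: "F \<in> C" for F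
  proof (rule ccontr)
    assume no: "\<not> (\<exists>V\<in>F. V \<subseteq> U)"
    have "closedin X (topspace X - U)" using U unfolding delta_map_def by auto
    moreover have "(topspace X - U) \<inter> V \<noteq> {}" if "V \<in> F" for V
      using no that openin_subset[OF assms[OF F that]] by blast
    ultimately have "topspace X - U \<in> diamonds X F" unfolding diamonds_def by blast
    then show False using U F unfolding delta_map_def diamond_def by blast
  qed
  then show "U \<in> {U. openin X U \<and> (\<forall>F\<in>C. \<exists>V\<in>F. V \<subseteq> U)}"
    using U unfolding delta_map_def by blast
next
  fix U assume U: "U \<in> {U. openin X U \<and> (\<forall>F\<in>C. \<exists>V\<in>F. V \<subseteq> U)}"
  have "A \<inter> U \<noteq> {}" if "F \<in> C" "A \<in> diamonds X F" for F A
  proof -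
    obtain V where "V \<in> F" "V \<subseteq> U" using U \<open>F \<in> C\<close> by blast
    moreover have "A \<inter> V \<noteq> {}" using that(2) \<open>V \<in> F\<close> unfolding diamonds_def by simp
    ultimately show ?thesis by blast
  qed
  with U show "U \<in> delta_map X (\<Union>F\<in>C. diamonds X F)"
    using diamonds_subset_closed[of X] unfolding delta_map_def diamond_def by blast
qed

lemma delta_map_antimono: "\<U> \<subseteq> \<V> \<Longrightarrow> delta_map X \<V> \<subseteq> delta_map X \<U>"
  unfolding delta_map_def by blast

text \<open>The union of any choice function on \<open>C\<close> lies in \<open>delta_map\<close>, hence in \<open>W\<close>, and by Scott
  openness finitely many of its values suffice. Tychonoff's theorem for the product of the finite
  sets in \<open>C\<close> makes the finite set of indices uniform.\<close>

lemma delta_map_finite_subfamily: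
  assumes fin: "\<And>F. F \<in> C \<Longrightarrow> finite F" and op: "\<And>F U. F \<in> C \<Longrightarrow> U \<in> F \<Longrightarrow> openin X U"
    and W: "Scott_open_in {U. openin X U} W"
    and sub: "delta_map X (\<Union>F\<in>C. diamonds X F) \<subseteq> W"
  shows "\<exists>C'. finite C' \<and> C' \<subseteq> C \<and> delta_map X (\<Union>F\<in>C'. diamonds X F) \<subseteq> W"
proof (cases "{} \<in> C")
  \<comment> \<open>\<open>diamonds X {}\<close> contains the empty closed set, so
    \<open>delta_map\<close> has an empty value there and the single index \<open>{}\<close>
    suffices. In the other case all members of \<open>C\<close> are nonempty, which permits
    extending a choice function from \<open>C'\<close> to \<open>C\<close>.\<close>
  case True
  have "delta_map X (\<Union>F\<in>{{}}. diamonds X F) = {}"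
    using delta_map_diamonds[of "{{}}" X] by simp
  then have "finite {{}} \<and> {{}} \<subseteq> C \<and> delta_map X (\<Union>F\<in>{{}}. diamonds X F) \<subseteq> W"
    using True by simp
  then show ?thesis by (rule exI)
next
  case ne: False
  define P where "P = product_topology (\<lambda>F. discrete_topology F) C"
  have P: "topspace P = (\<Pi>\<^sub>E F\<in>C. F)" unfolding P_def by simp
  have cP: "compact_space P"
    unfolding P_def compact_space_product_topology using fin
    by (simp add: compact_space_discrete_topology)
  \<comment> \<open>The choice functions for which the indices in \<open>I\<close> already suffice.
    Membership depends only on the finitely many coordinates in \<open>I\<close>, which makes
    \<open>T I\<close> open in the product.\<close>
  define T where "T I = {f \<in> \<Pi>\<^sub>E F\<in>C. F. \<Union>(f ` I) \<in> W}" for I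
  have T: "openin P (T I)" if I: "finite I" "I \<subseteq> C" for I
  proof (subst openin_subopen, intro ballI)
    fix f assume f: "f \<in> T I"
    define B where "B = (\<Pi>\<^sub>E F\<in>C. if F \<in> I then {f F} else F)"
    have fF: "f F \<in> F" if "F \<in> C" for F using f that unfolding T_def by auto
    have "openin P B"
      unfolding B_def P_def
    proof (rule product_topology_basis)
      show "openin (discrete_topology F) (if F \<in> I then {f F} else F)" for F
        using fF I(2) by (auto simp: subset_iff)
      have "{F. (if F \<in> I then {f F} else F) \<noteq> topspace (discrete_topology F)} \<subseteq> I" by auto
      then show "finite {F. (if F \<in> I then {f F} else F) \<noteq> topspace (discrete_topology F)}"
        using I(1) by (rule finite_subset)
    qed
    moreover have "f \<in> B" using f unfolding B_def T_def by (auto simp: PiE_iff)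
    moreover have "B \<subseteq> T I"
    proof
      fix g assume g: "g \<in> B"
      have val: "g F \<in> (if F \<in> I then {f F} else F)" if "F \<in> C" for F
        using g that unfolding B_def by (rule PiE_mem)
      have "g F = f F" if "F \<in> I" for F using val[of F] that I(2) by auto
      then have "\<Union>(g ` I) = \<Union>(f ` I)" by auto
      moreover have "g F \<in> F" if "F \<in> C" for F
        using val[OF that] fF[OF that] by (auto split: if_splits)
      then have "g \<in> (\<Pi>\<^sub>E F\<in>C. F)" using g unfolding B_def by (auto simp: PiE_iff)
      ultimately show "g \<in> T I" using f unfolding T_def by simp
    qed
    ultimately show "\<exists>T'. openin P T' \<and> f \<in> T' \<and> T' \<subseteq> T I" by blast
  qed
  define \<I> where "\<I> = {I. finite I \<and> I \<subseteq> C}"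
  have "topspace P \<subseteq> \<Union>(T ` \<I>)"
  proof
    fix f assume "f \<in> topspace P"
    then have f: "f \<in> (\<Pi>\<^sub>E F\<in>C. F)" using P by simp
    then have fF: "f F \<in> F" if "F \<in> C" for F using that by auto
    have opf: "openin X U" if "U \<in> f ` C" for U using that fF op by blast
    have "openin X (\<Union>(f ` C))" using opf by (rule openin_Union)
    moreover have "\<forall>F\<in>C. \<exists>V\<in>F. V \<subseteq> \<Union>(f ` C)" using fF by blast
    ultimately have "\<Union>(f ` C) \<in> delta_map X (\<Union>F\<in>C. diamonds X F)"
      using delta_map_diamonds[of C X] op by simp
    then have "\<Union>(f ` C) \<in> W" using sub by blast
    then obtain C' where "finite C'" "C' \<subseteq> f ` C" "\<Union>C' \<in> W"
      using Scott_open_in_finite_subfamily[OF W, of "f ` C"] opf by blast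
    then obtain I where "finite I" "I \<subseteq> C" "\<Union>(f ` I) \<in> W" by (metis finite_subset_image)
    then show "f \<in> \<Union>(T ` \<I>)" using f unfolding T_def \<I>_def by blast
  qed
  moreover have "\<forall>U\<in>T ` \<I>. openin P U" using T unfolding \<I>_def by blast
  ultimately obtain \<F> where \<F>: "finite \<F>" "\<F> \<subseteq> T ` \<I>" "topspace P \<subseteq> \<Union>\<F>"
    using cP unfolding compact_space_alt by metis
  then obtain \<J> where \<J>: "finite \<J>" "\<J> \<subseteq> \<I>" "\<F> = T ` \<J>" by (meson finite_subset_image)
  define C' where "C' = \<Union>\<J>"
  have C': "finite C'" "C' \<subseteq> C" using \<J> unfolding C'_def \<I>_def by auto
  have "U \<in> W" if U: "U \<in> delta_map X (\<Union>F\<in>C'. diamonds X F)" for U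
  proof -
    have U': "openin X U" "\<forall>F\<in>C'. \<exists>V\<in>F. V \<subseteq> U"
      using U delta_map_diamonds[of C' X] op C'(2) by blast+
    \<comment> \<open>On \<open>C'\<close> the values are taken inside \<open>U\<close>, elsewhere
      arbitrarily. Some \<open>T I\<close> with \<open>I \<subseteq> C'\<close> contains
      \<open>f\<close>, so a member of \<open>W\<close> lies below \<open>U\<close>.\<close>
    define f where "f = (\<lambda>F\<in>C. if F \<in> C' then SOME V. V \<in> F \<and> V \<subseteq> U else SOME V. V \<in> F)"
    have f1: "f F \<in> F \<and> f F \<subseteq> U" if "F \<in> C'" for F
    proof -
      have "\<exists>V. V \<in> F \<and> V \<subseteq> U" using U'(2) that by blast
      from someI_ex[OF this] show ?thesis using that C'(2) unfolding f_def by auto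
    qed
    have f2: "f F \<in> F" if "F \<in> C" for F
    proof (cases "F \<in> C'")
      case False
      have "\<exists>V. V \<in> F" using ne that by (metis ex_in_conv)
      from someI_ex[OF this] show ?thesis using that False unfolding f_def by auto
    qed (use f1 in blast)
    have "f \<in> (\<Pi>\<^sub>E F\<in>C. F)" using f2 unfolding f_def by (auto simp: PiE_iff)
    then obtain I where I: "I \<in> \<J>" "f \<in> T I" using P \<F>(3) \<J>(3) by blast
    then have "\<Union>(f ` I) \<in> W" unfolding T_def by blast
    moreover have "\<Union>(f ` I) \<subseteq> U" using f1 I(1) unfolding C'_def by blast
    ultimately show ?thesis using Scott_open_inD(2)[OF W] U'(1) by blast
  qed
  then show ?thesis using C' by blast
qed

lemma openin_closeds_space_eq_Union_diamonds:
  assumes "openin (closeds_space X) \<U>"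
  shows "\<U> = (\<Union>F\<in>{F. finite F \<and> (\<forall>U\<in>F. openin X U) \<and> diamonds X F \<subseteq> \<U>}. diamonds X F)"
proof
  show "\<U> \<subseteq> (\<Union>F\<in>{F. finite F \<and> (\<forall>U\<in>F. openin X U) \<and> diamonds X F \<subseteq> \<U>}. diamonds X F)"
  proof
    fix A assume "A \<in> \<U>"
    then obtain F where "finite F" "\<forall>U\<in>F. openin X U" "A \<in> diamonds X F" "diamonds X F \<subseteq> \<U>"
      using assms unfolding openin_closeds_space by meson
    then show "A \<in> (\<Union>F\<in>{F. finite F \<and> (\<forall>U\<in>F. openin X U) \<and> diamonds X F \<subseteq> \<U>}. diamonds X F)"
      by (intro UN_I[of F]) simp_all
  qed
qed blast

text \<open>By \<open>delta_map_finite_subfamily\<close>, a cover of \<open>delta_map X \<U>\<close>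
  covers the larger \<open>delta_map\<close> of a finite union of basic sets. That one is the upper
  set of finitely many open sets, and the members of the cover are upward closed.\<close>

lemma compactin_delta_map:
  assumes "openin (closeds_space X) \<U>"
  shows "compactin (opens_space X) (delta_map X \<U>)"
  unfolding compactin_def
proof (intro conjI allI impI)
  show "delta_map X \<U> \<subseteq> topspace (opens_space X)"
    unfolding delta_map_def opens_space_def by auto
  fix \<W> assume \<W>: "Ball \<W> (openin (opens_space X)) \<and> delta_map X \<U> \<subseteq> \<Union>\<W>"
  then have "openin (opens_space X) (\<Union>\<W>)" by blast
  then have W: "Scott_open_in {U. openin X U} (\<Union>\<W>)"
    unfolding opens_space_def openin_Scott_topology .
  define C where "C = {F. finite F \<and> (\<forall>U\<in>F. openin X U) \<and> diamonds X F \<subseteq> \<U>}"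
  have \<U>: "\<U> = (\<Union>F\<in>C. diamonds X F)"
    unfolding C_def by (rule openin_closeds_space_eq_Union_diamonds[OF assms])
  have C: "finite F" "\<forall>U\<in>F. openin X U" if "F \<in> C" for F
    using that unfolding C_def by blast+
  have "delta_map X (\<Union>F\<in>C. diamonds X F) \<subseteq> \<Union>\<W>" using \<W> \<U> by simp
  then obtain C' where C': "finite C'" "C' \<subseteq> C" "delta_map X (\<Union>F\<in>C'. diamonds X F) \<subseteq> \<Union>\<W>"
    using delta_map_finite_subfamily[of C X, OF _ _ W] C by metis
  have op: "\<And>F U. F \<in> C' \<Longrightarrow> U \<in> F \<Longrightarrow> openin X U" using C(2) C'(2) by blast
  note delta = delta_map_diamonds[of C' X, OF op]
  \<comment> \<open>The finitely many generators: every open set that includes a member of each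
    \<open>F \<in> C'\<close> includes the union of some choice function on
    \<open>C'\<close>.\<close>
  define \<G> where "\<G> = (\<lambda>f. \<Union>(f ` C')) ` (\<Pi>\<^sub>E F\<in>C'. F)"
  have fin: "finite \<G>"
    unfolding \<G>_def using C'(1,2) C(1) by (intro finite_imageI finite_PiE) auto
  have "\<G> \<subseteq> \<Union>\<W>"
  proof
    fix G assume "G \<in> \<G>"
    then obtain f where f: "f \<in> (\<Pi>\<^sub>E F\<in>C'. F)" and G: "G = \<Union>(f ` C')" unfolding \<G>_def by blast
    have fF: "f F \<in> F" if "F \<in> C'" for F using f that by auto
    have "openin X G" unfolding G using fF op by blast
    moreover have "\<forall>F\<in>C'. \<exists>V\<in>F. V \<subseteq> G" unfolding G using fF by blast
    ultimately have "G \<in> delta_map X (\<Union>F\<in>C'. diamonds X F)" using delta by simp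
    then show "G \<in> \<Union>\<W>" using C'(3) by blast
  qed
  then have "\<forall>G\<in>\<G>. \<exists>W. W \<in> \<W> \<and> G \<in> W" by blast
  from bchoice[OF this] obtain h where h: "\<And>G. G \<in> \<G> \<Longrightarrow> h G \<in> \<W> \<and> G \<in> h G" by blast
  have "delta_map X \<U> \<subseteq> \<Union>(h ` \<G>)"
  proof
    fix U assume U: "U \<in> delta_map X \<U>"
    have "(\<Union>F\<in>C'. diamonds X F) \<subseteq> \<U>" using \<U> C'(2) by blast
    then have "U \<in> delta_map X (\<Union>F\<in>C'. diamonds X F)" using U delta_map_antimono by blast
    then have oU: "openin X U" and ex: "\<forall>F\<in>C'. \<exists>V. V \<in> F \<and> V \<subseteq> U" using delta by auto
    obtain f where f: "\<forall>F\<in>C'. f F \<in> F \<and> f F \<subseteq> U" using bchoice[OF ex] by blast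
    define G where "G = \<Union>(restrict f C' ` C')"
    have "restrict f C' \<in> (\<Pi>\<^sub>E F\<in>C'. F)" using f by simp
    then have G: "G \<in> \<G>" unfolding \<G>_def G_def by blast
    have "G \<subseteq> U" unfolding G_def using f by auto
    moreover have "openin (opens_space X) (h G)" "G \<in> h G" using h[OF G] \<W> by auto
    ultimately have "U \<in> h G"
      using Scott_open_inD(2)[of _ "h G" G U] oU unfolding opens_space_def openin_Scott_topology by auto
    then show "U \<in> \<Union>(h ` \<G>)" using G by blast
  qed
  moreover have "h ` \<G> \<subseteq> \<W>" using h by blast
  ultimately show "\<exists>\<F>. finite \<F> \<and> \<F> \<subseteq> \<W> \<and> delta_map X \<U> \<subseteq> \<Union>\<F>"
    using fin by (intro exI[of _ "h ` \<G>"]) simp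
qed

text \<open>Within the open sets, \<open>delta_map X \<U>\<close> is the intersection over
  \<open>A \<in> \<U>\<close> of the Scott open families of sets meeting \<open>A\<close>.\<close>

lemma saturatedin_delta_map:
  assumes "\<And>A. A \<in> \<U> \<Longrightarrow> closedin X A"
  shows "saturatedin (opens_space X) (delta_map X \<U>)"
  unfolding saturatedin_def
proof
  show "delta_map X \<U> \<subseteq> \<Inter> {W. openin (opens_space X) W \<and> delta_map X \<U> \<subseteq> W}" by blast
  show "\<Inter> {W. openin (opens_space X) W \<and> delta_map X \<U> \<subseteq> W} \<subseteq> delta_map X \<U>"
  proof
    fix U assume U: "U \<in> \<Inter> {W. openin (opens_space X) W \<and> delta_map X \<U> \<subseteq> W}"
    have mem: "U \<in> W" if "openin (opens_space X) W" "delta_map X \<U> \<subseteq> W" for W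
      using U that by blast
    have "delta_map X \<U> \<subseteq> topspace (opens_space X)"
      unfolding delta_map_def opens_space_def by auto
    then have "U \<in> topspace (opens_space X)" using mem openin_topspace by blast
    then have "openin X U" unfolding opens_space_def by simp
    moreover have "A \<inter> U \<noteq> {}" if A: "A \<in> \<U>" for A
    proof -
      have "openin (opens_space X) {U. openin X U \<and> A \<inter> U \<noteq> {}}"
        unfolding opens_space_def openin_Scott_topology by (rule Scott_open_in_meeting)
      moreover have "delta_map X \<U> \<subseteq> {U. openin X U \<and> A \<inter> U \<noteq> {}}"
        using A unfolding delta_map_def diamond_def by blast
      ultimately show ?thesis using mem by blast
    qed
    ultimately show "U \<in> delta_map X \<U>" unfolding delta_map_def diamond_def using assms by blast
  qed
qed

lemma delta_map_compact_saturated: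
  assumes "openin (closeds_space X) \<U>"
  shows "delta_map X \<U> \<in> compact_saturated (opens_space X)"
  using compactin_delta_map[OF assms]
    saturatedin_delta_map[OF openin_closeds_space_closed[OF assms]]
  unfolding compact_saturated_def by simp

lemma continuous_map_delta_map:
  "continuous_map (opens_space (closeds_space X)) (compacts_space (opens_space X)) (delta_map X)"
  unfolding continuous_map
proof (intro conjI allI impI)
  let ?A = "closeds_space X"
  show "delta_map X ` topspace (opens_space ?A) \<subseteq> topspace (compacts_space (opens_space X))"
    unfolding topspace_compacts_space using delta_map_compact_saturated
    by (auto simp: opens_space_def)
  fix \<W> assume \<W>: "openin (compacts_space (opens_space X)) \<W>"
  show "openin (opens_space ?A) {\<U> \<in> topspace (opens_space ?A). delta_map X \<U> \<in> \<W>}"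
  proof (subst openin_subopen, intro ballI)
    fix \<U> assume "\<U> \<in> {\<U> \<in> topspace (opens_space ?A). delta_map X \<U> \<in> \<W>}"
    then have \<U>: "openin ?A \<U>" "delta_map X \<U> \<in> \<W>" by (auto simp: opens_space_def)
    obtain W where W: "openin (opens_space X) W" "delta_map X \<U> \<subseteq> W" "box_set (opens_space X) W \<subseteq> \<W>"
      using \<W> \<U>(2) unfolding openin_compacts_space box_set_def by blast
    have SW: "Scott_open_in {U. openin X U} W"
      using W(1) unfolding opens_space_def openin_Scott_topology .
    define H where "H = {\<V>. openin ?A \<V> \<and> delta_map X \<V> \<subseteq> W}"
    have "openin (opens_space ?A) H"
      unfolding opens_space_def openin_Scott_topology
    proof (rule Scott_open_in_opensI)
      fix \<V> \<V>' assume "\<V> \<in> H" "openin ?A \<V>'" "\<V> \<subseteq> \<V>'"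
      then show "\<V>' \<in> H" using delta_map_antimono[of \<V> \<V>' X] unfolding H_def by blast
    next
      fix D assume D: "\<And>\<V>. \<V> \<in> D \<Longrightarrow> openin ?A \<V>" "directed_set D" "\<Union>D \<in> H"
      \<comment> \<open>Each basic set in \<open>C\<close> lies in a single member of
        \<open>D\<close>. Finitely many of them therefore lie in one common member \<open>Z\<close>,
        to which antitonicity of \<open>delta_map\<close> applies.\<close>
      define C where "C = {F. finite F \<and> (\<forall>U\<in>F. openin X U) \<and> (\<exists>\<V>\<in>D. diamonds X F \<subseteq> \<V>)}"
      have C: "finite F" "\<forall>U\<in>F. openin X U" "\<exists>\<V>\<in>D. diamonds X F \<subseteq> \<V>" if "F \<in> C" for F
        using that unfolding C_def by blast+
      have "(\<Union>F\<in>C. diamonds X F) = \<Union>D"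
      proof
        show "(\<Union>F\<in>C. diamonds X F) \<subseteq> \<Union>D" using C(3) by blast
        show "\<Union>D \<subseteq> (\<Union>F\<in>C. diamonds X F)"
        proof
          fix A assume "A \<in> \<Union>D"
          then obtain \<V> where \<V>: "\<V> \<in> D" "A \<in> \<V>" by blast
          then obtain F where "finite F" "\<forall>U\<in>F. openin X U" "A \<in> diamonds X F" "diamonds X F \<subseteq> \<V>"
            using D(1)[OF \<V>(1)] unfolding openin_closeds_space by blast
          then show "A \<in> (\<Union>F\<in>C. diamonds X F)" using \<V>(1) unfolding C_def by blast
        qed
      qed
      then have "delta_map X (\<Union>F\<in>C. diamonds X F) \<subseteq> W" using D(3) unfolding H_def by simp
      then obtain C' where C': "finite C'" "C' \<subseteq> C" "delta_map X (\<Union>F\<in>C'. diamonds X F) \<subseteq> W"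
        using delta_map_finite_subfamily[of C X, OF _ _ SW] C by metis
      have "\<forall>F\<in>C'. \<exists>\<V>. \<V> \<in> D \<and> diamonds X F \<subseteq> \<V>" using C(3) C'(2) by blast
      then obtain v where v: "\<forall>F\<in>C'. v F \<in> D \<and> diamonds X F \<subseteq> v F" using bchoice by metis
      obtain Z where Z: "Z \<in> D" "\<forall>\<V>\<in>v ` C'. \<V> \<subseteq> Z"
        using directed_set_finite_upper_bound[OF D(2), of "v ` C'"] C'(1) v by blast
      have "(\<Union>F\<in>C'. diamonds X F) \<subseteq> Z" using v Z(2) by blast
      then have "delta_map X Z \<subseteq> W" using C'(3) delta_map_antimono by blast
      then show "\<exists>\<V>\<in>D. \<V> \<in> H" using Z(1) D(1) unfolding H_def by blast
    qed (simp add: H_def)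
    moreover have "\<U> \<in> H" using \<U>(1) W(2) unfolding H_def by blast
    moreover have "H \<subseteq> {\<U> \<in> topspace (opens_space ?A). delta_map X \<U> \<in> \<W>}"
    proof
      fix \<V> assume "\<V> \<in> H"
      then have "openin ?A \<V>" "delta_map X \<V> \<subseteq> W" unfolding H_def by auto
      then have "delta_map X \<V> \<in> box_set (opens_space X) W"
        using delta_map_compact_saturated unfolding box_set_def by blast
      then show "\<V> \<in> {\<U> \<in> topspace (opens_space ?A). delta_map X \<U> \<in> \<W>}"
        using \<open>openin ?A \<V>\<close> W(3) by (auto simp: opens_space_def)
    qed
    ultimately show "\<exists>T. openin (opens_space ?A) T \<and> \<U> \<in> T \<and>
        T \<subseteq> {\<U> \<in> topspace (opens_space ?A). delta_map X \<U> \<in> \<W>}" by blast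
  qed
qed

section \<open>The maps are mutually inverse\<close>

text \<open>If an open \<open>V\<close> is not in \<open>\<KK>\<close>, saturation forbids members
  of \<open>\<KK>\<close> inside \<open>V\<close>; the complement of \<open>V\<close> then belongs
  to \<open>gamma_map X \<KK>\<close> but misses \<open>V\<close>.\<close>

lemma delta_gamma:
  assumes "\<KK> \<in> compact_saturated (opens_space X)"
  shows "delta_map X (gamma_map X \<KK>) = \<KK>"
proof
  have sat: "saturatedin (opens_space X) \<KK>"
    and op: "\<And>U. U \<in> \<KK> \<Longrightarrow> openin X U"
    using assms compactin_subset_topspace[of "opens_space X" \<KK>]
    unfolding compact_saturated_def opens_space_def by auto
  show "\<KK> \<subseteq> delta_map X (gamma_map X \<KK>)"
    using op unfolding delta_map_def gamma_map_def by blast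
  show "delta_map X (gamma_map X \<KK>) \<subseteq> \<KK>"
  proof (rule subsetI, rule ccontr)
    fix V assume V: "V \<in> delta_map X (gamma_map X \<KK>)" "V \<notin> \<KK>"
    then have oV: "openin X V" unfolding delta_map_def by blast
    have "(topspace X - V) \<inter> U \<noteq> {}" if "U \<in> \<KK>" for U
    proof
      assume "(topspace X - V) \<inter> U = {}"
      then have "U \<subseteq> V" using openin_subset[OF op[OF that]] by blast
      then show False using saturatedin_opens_space_upward[OF sat that oV] V(2) by blast
    qed
    then have "topspace X - V \<in> gamma_map X \<KK>"
      using oV unfolding gamma_map_def diamond_def by auto
    then show False using V(1) unfolding delta_map_def diamond_def by blast
  qed
qed

text \<open>Dually, if a closed \<open>A\<close> is not in \<open>\<U>\<close>, upward closure
  forbids members of \<open>\<U>\<close> inside \<open>A\<close>; the complement of \<open>A\<close>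
  then belongs to \<open>delta_map X \<U>\<close> but misses \<open>A\<close>.\<close>

lemma gamma_delta:
  assumes "openin (closeds_space X) \<U>"
  shows "gamma_map X (delta_map X \<U>) = \<U>"
proof
  show "\<U> \<subseteq> gamma_map X (delta_map X \<U>)"
    using openin_closeds_space_closed[OF assms] unfolding delta_map_def gamma_map_def by blast
  show "gamma_map X (delta_map X \<U>) \<subseteq> \<U>"
  proof (rule subsetI, rule ccontr)
    fix A assume A: "A \<in> gamma_map X (delta_map X \<U>)" "A \<notin> \<U>"
    then have cA: "closedin X A" unfolding gamma_map_def by blast
    have "B \<inter> (topspace X - A) \<noteq> {}" if "B \<in> \<U>" for B
    proof
      assume "B \<inter> (topspace X - A) = {}"
      then have "B \<subseteq> A"
        using closedin_subset[OF openin_closeds_space_closed[OF assms that]] by blast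
      then show False using openin_closeds_space_upward[OF assms that cA] A(2) by blast
    qed
    then have "topspace X - A \<in> delta_map X \<U>"
      using cA openin_closeds_space_closed[OF assms] unfolding delta_map_def diamond_def by auto
    then show False using A(1) unfolding gamma_map_def diamond_def by blast
  qed
qed

section \<open>Consonance of the space of closed sets\<close>

fun has_path :: "(nat \<Rightarrow> 'b set) \<Rightarrow> ('b \<Rightarrow> 'b \<Rightarrow> bool) \<Rightarrow> nat \<Rightarrow> nat \<Rightarrow> 'b \<Rightarrow> bool" where
  "has_path J R 0 n x \<longleftrightarrow> x \<in> J n"
| "has_path J R (Suc m) n x \<longleftrightarrow> x \<in> J n \<and> (\<exists>y. R x y \<and> has_path J R m (Suc n) y)"

lemma has_path_mem: "has_path J R m n x \<Longrightarrow> x \<in> J n"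
  by (cases m) auto

lemma has_path_Suc: "has_path J R (Suc m) n x \<Longrightarrow> has_path J R m n x"
  by (induction m arbitrary: n x) (auto dest: has_path_mem)

text \<open>If every \<open>x\<close> failed at some index, none would be left at the largest of
  these finitely many indices.\<close>

lemma finite_antimono_witness:
  fixes Q :: "nat \<Rightarrow> 'b \<Rightarrow> bool"
  assumes "finite S" and ex: "\<And>m. \<exists>x\<in>S. Q m x" and anti: "\<And>m x. Q (Suc m) x \<Longrightarrow> Q m x"
  shows "\<exists>x\<in>S. \<forall>m. Q m x"
proof (rule ccontr)
  assume "\<not> ?thesis"
  then have "\<forall>x\<in>S. \<exists>m. \<not> Q m x" by blast
  then obtain f where f: "\<forall>x\<in>S. \<not> Q (f x) x" by metis
  have le: "Q m x" if "m \<le> m'" "Q m' x" for m m' x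
    using that by (induction rule: dec_induct) (auto intro: anti)
  obtain x where x: "x \<in> S" "Q (Max (f ` S)) x" using ex by blast
  have "f x \<le> Max (f ` S)" using x(1) assms(1) by simp
  then show False using le x f by blast
qed

lemma infinite_path_in_finite_levels:
  assumes fin: "\<And>n. finite (J n)" and ne: "\<And>n. J n \<noteq> {}"
    and par: "\<And>n y. y \<in> J (Suc n) \<Longrightarrow> \<exists>x\<in>J n. R x y"
  shows "\<exists>f. \<forall>n. f n \<in> J n \<and> R (f n) (f (Suc n))"
proof -
  have ex: "\<exists>x. has_path J R m n x" for m n
  proof (induction m arbitrary: n)
    case 0
    then show ?case using ne by auto
  next
    case (Suc m)
    then obtain y where y: "has_path J R m (Suc n) y" by blast
    then obtain x where "x \<in> J n" "R x y" using par has_path_mem by metis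
    then show ?case using y by auto
  qed
  \<comment> \<open>The invariant is that paths of every length start at \<open>f n\<close>; by
    \<open>finite_antimono_witness\<close> some single successor inherits it.\<close>
  have "\<exists>f. \<forall>n. (\<forall>m. has_path J R m n (f n)) \<and> R (f n) (f (Suc n))"
  proof (rule dependent_nat_choice)
    show "\<exists>x. \<forall>m. has_path J R m 0 x"
      using finite_antimono_witness[OF fin[of 0], of "\<lambda>m x. has_path J R m 0 x"] ex
        has_path_mem has_path_Suc by metis
  next
    fix x n assume x: "\<forall>m. has_path J R m n x"
    have "\<exists>y\<in>J (Suc n). \<forall>m. R x y \<and> has_path J R m (Suc n) y"
    proof (rule finite_antimono_witness[OF fin])
      fix m
      show "\<exists>y\<in>J (Suc n). R x y \<and> has_path J R m (Suc n) y"
        using x[rule_format, of "Suc m"] has_path_mem by fastforce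
    qed (metis has_path_Suc)
    then show "\<exists>y. (\<forall>m. has_path J R m (Suc n) y) \<and> R x y" by blast
  qed
  then show ?thesis using has_path_mem by metis
qed

section \<open>Smyth-complete quasi-metrics and nested balls\<close>

locale Smyth_quasi_metric =
  fixes X :: "'a topology" and d :: "'a \<Rightarrow> 'a \<Rightarrow> real"
  assumes quasi_metric: "quasi_metric_on (topspace X) d"
    and complete: "Smyth_complete (topspace X) d"
    and induced: "X = quasi_metric_topology (topspace X) d"
begin

abbreviation qball :: "'a \<Rightarrow> real \<Rightarrow> 'a set" where
  "qball \<equiv> quasi_metric_ball (topspace X) d"

lemma dist_self: "x \<in> topspace X \<Longrightarrow> d x x = 0"
  using quasi_metric unfolding quasi_metric_on_def by blast

lemma dist_triangle:
  "x \<in> topspace X \<Longrightarrow> y \<in> topspace X \<Longrightarrow> z \<in> topspace X \<Longrightarrow> d x z \<le> d x y + d y z"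
  using quasi_metric unfolding quasi_metric_on_def by blast

lemma openin_iff: "openin X U \<longleftrightarrow> U \<subseteq> topspace X \<and> (\<forall>x\<in>U. \<exists>e>0. qball x e \<subseteq> U)"
  using openin_quasi_metric_topology[of "topspace X" d U] induced by simp

lemma openin_qball:
  assumes "x \<in> topspace X" shows "openin X (qball x e)"
  unfolding openin_iff
proof (intro conjI ballI)
  show "qball x e \<subseteq> topspace X" unfolding quasi_metric_ball_def by blast
  fix y assume y: "y \<in> qball x e"
  have "qball y (e - d x y) \<subseteq> qball x e"
  proof
    fix z assume "z \<in> qball y (e - d x y)"
    then show "z \<in> qball x e"
      using y dist_triangle[of x y z] assms unfolding quasi_metric_ball_def by auto
  qed
  then show "\<exists>r>0. qball y r \<subseteq> qball x e"
    using y by (intro exI[of _ "e - d x y"]) (auto simp: quasi_metric_ball_def)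
qed

text \<open>Turns convergence for the symmetrised distance into estimates for \<open>d\<close> in
  both directions.\<close>

lemma Cauchy_limit:
  assumes "range \<sigma> \<subseteq> topspace X" "quasi_metric_Cauchy d \<sigma>"
  shows "\<exists>l\<in>topspace X. \<forall>e>0. eventually (\<lambda>n. d (\<sigma> n) l < e \<and> d l (\<sigma> n) < e) sequentially"
proof -
  let ?s = "\<lambda>x y. max (d x y) (d y x)"
  let ?Y = "quasi_metric_topology (topspace X) ?s"
  obtain l where l: "limitin ?Y \<sigma> l sequentially"
    using complete assms unfolding Smyth_complete_def by blast
  have lX: "l \<in> topspace X"
    using l openin_topspace[of ?Y] unfolding limitin_def openin_quasi_metric_topology by blast
  have "eventually (\<lambda>n. d (\<sigma> n) l < e \<and> d l (\<sigma> n) < e) sequentially" if "e > 0" for e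
  proof -
    let ?B = "quasi_metric_ball (topspace X) ?s l e"
    have "openin ?Y ?B"
      unfolding openin_quasi_metric_topology
    proof (intro conjI ballI)
      show "?B \<subseteq> topspace X" unfolding quasi_metric_ball_def by blast
      fix y assume y: "y \<in> ?B"
      have "quasi_metric_ball (topspace X) ?s y (e - ?s l y) \<subseteq> ?B"
      proof
        fix z assume "z \<in> quasi_metric_ball (topspace X) ?s y (e - ?s l y)"
        then show "z \<in> ?B"
          using y dist_triangle[of l y z] dist_triangle[of z y l] lX
          unfolding quasi_metric_ball_def by auto
      qed
      then show "\<exists>r>0. quasi_metric_ball (topspace X) ?s y r \<subseteq> ?B"
        using y by (intro exI[of _ "e - ?s l y"]) (auto simp: quasi_metric_ball_def)
    qed
    moreover have "l \<in> ?B" using lX dist_self[OF lX] that unfolding quasi_metric_ball_def by simp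
    ultimately have "eventually (\<lambda>n. \<sigma> n \<in> ?B) sequentially" using l unfolding limitin_def by blast
    then show ?thesis by eventually_elim (simp add: quasi_metric_ball_def)
  qed
  then show ?thesis using lX by blast
qed

text \<open>The nesting condition telescopes, so the centres form a Cauchy sequence. That the balls
  finally enter each neighbourhood of \<open>l\<close> rests on \<open>d l (x n)\<close> tending to
  0, the direction that Smyth completeness supplies.\<close>

lemma nested_qballs_limit:
  assumes x: "\<And>n. x n \<in> topspace X" and e: "\<And>n. 0 < e n" "e \<longlonglongrightarrow> 0"
    and nested: "\<And>n. d (x n) (x (Suc n)) + e (Suc n) < e n"
  shows "\<exists>l\<in>topspace X. (\<forall>n. l \<in> qball (x n) (e n)) \<and>
    (\<forall>V. openin X V \<longrightarrow> l \<in> V \<longrightarrow> (\<exists>N. \<forall>n\<ge>N. qball (x n) (e n) \<subseteq> V))"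
proof -
  have dist: "d (x n) (x m) + e m \<le> e n" if "n \<le> m" for n m
    using that
  proof (induction rule: dec_induct)
    case base
    then show ?case using dist_self[OF x] by simp
  next
    case (step m)
    then show ?case using dist_triangle[OF x x x, of n "Suc m" m] nested[of m] by linarith
  qed
  have "quasi_metric_Cauchy d x"
    unfolding quasi_metric_Cauchy_def
  proof (intro allI impI)
    fix r :: real assume "r > 0"
    then obtain N where N: "\<forall>n\<ge>N. e n < r"
      using order_tendstoD(2)[OF e(2)] unfolding eventually_sequentially by blast
    have "d (x n) (x m) < r" if "n \<ge> N" "m \<ge> n" for n m
      using dist[OF that(2)] e(1)[of m] N that(1) by force
    then show "\<exists>N. \<forall>n\<ge>N. \<forall>m\<ge>n. d (x n) (x m) < r" by blast
  qed
  then obtain l where l: "l \<in> topspace X"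
    and lim: "\<And>r. r > 0 \<Longrightarrow> eventually (\<lambda>n. d (x n) l < r \<and> d l (x n) < r) sequentially"
    using Cauchy_limit[of x] x by blast
  have "l \<in> qball (x n) (e n)" for n
  proof -
    \<comment> \<open>The slack of the strict nesting at \<open>n\<close>; it places the limit
      inside the open ball.\<close>
    define r where "r = e n - (d (x n) (x (Suc n)) + e (Suc n))"
    have "r > 0" using nested[of n] unfolding r_def by simp
    have "eventually (\<lambda>m. d (x m) l < r \<and> m \<ge> Suc n) sequentially"
      using lim[OF \<open>r > 0\<close>] eventually_ge_at_top[of "Suc n"] by eventually_elim simp
    then obtain m where m: "d (x m) l < r" "m \<ge> Suc n"
      using eventually_happens'[OF sequentially_bot] by blast
    have "d (x n) l \<le> d (x n) (x (Suc n)) + (d (x (Suc n)) (x m) + d (x m) l)"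
      using dist_triangle[OF x x l, of n "Suc n"] dist_triangle[OF x x l, of "Suc n" m] by linarith
    also have "\<dots> < e n" using dist[OF m(2)] m(1) e(1)[of m] unfolding r_def by linarith
    finally show ?thesis using l unfolding quasi_metric_ball_def by simp
  qed
  moreover have "\<exists>N. \<forall>n\<ge>N. qball (x n) (e n) \<subseteq> V" if V: "openin X V" "l \<in> V" for V
  proof -
    obtain r where r: "r > 0" "qball l r \<subseteq> V" using V unfolding openin_iff by blast
    have "eventually (\<lambda>n. d l (x n) < r / 2 \<and> e n < r / 2) sequentially"
      using lim[of "r / 2"] order_tendstoD(2)[OF e(2), of "r / 2"] r(1)
      by (simp add: eventually_conj_iff)
    then obtain N where N: "\<forall>n\<ge>N. d l (x n) < r / 2 \<and> e n < r / 2"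
      unfolding eventually_sequentially by blast
    have "qball (x n) (e n) \<subseteq> qball l r" if "n \<ge> N" for n
    proof
      fix z assume z: "z \<in> qball (x n) (e n)"
      then have "z \<in> topspace X" "d (x n) z < e n" unfolding quasi_metric_ball_def by auto
      moreover have "d l z \<le> d l (x n) + d (x n) z" using dist_triangle[of l "x n" z] l x calculation by blast
      moreover have "d l (x n) < r / 2" "e n < r / 2" using N that by auto
      ultimately show "z \<in> qball l r" unfolding quasi_metric_ball_def by simp
    qed
    then show ?thesis using r(2) by blast
  qed
  ultimately show ?thesis using l by blast
qed

section \<open>Finite systems of balls as basic open sets of closed sets\<close>

definition ball_system :: "nat \<Rightarrow> ('a \<times> real) set \<Rightarrow> bool" where
  "ball_system n G \<longleftrightarrow> finite G \<and> (\<forall>(x, e)\<in>G. x \<in> topspace X \<and> 0 < e \<and> e \<le> (1/2) ^ n)"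

text \<open>Formulated with centres and radii, which the balls as sets need not determine, and with
  strict slack, so that a chain of refinements satisfies the hypothesis of
  \<open>nested_qballs_limit\<close>. Each ball of \<open>G\<close> shrinks to one of
  \<open>G'\<close>.\<close>

definition ball_refines :: "('a \<times> real) set \<Rightarrow> ('a \<times> real) set \<Rightarrow> bool" where
  "ball_refines G G' \<longleftrightarrow> (\<forall>(x, e)\<in>G. \<exists>(x', e')\<in>G'. d x x' + e' < e)"

definition meets_balls :: "('a \<times> real) set \<Rightarrow> 'a set set" where
  "meets_balls G = diamonds X ((\<lambda>(x, e). qball x e) ` G)"

lemma ball_systemD:
  assumes "ball_system n G" "(x, e) \<in> G"
  shows "x \<in> topspace X" "0 < e" "e \<le> (1/2) ^ n"
  using assms unfolding ball_system_def by auto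

lemma mem_meets_balls:
  "A \<in> meets_balls G \<longleftrightarrow> closedin X A \<and> (\<forall>(x, e)\<in>G. A \<inter> qball x e \<noteq> {})"
  unfolding meets_balls_def diamonds_def by auto

lemma openin_meets_balls: "ball_system n G \<Longrightarrow> openin (closeds_space X) (meets_balls G)"
  unfolding meets_balls_def
  by (rule openin_closeds_space_diamonds) (auto simp: ball_system_def intro: openin_qball)

lemma meets_balls_antimono:
  assumes "ball_system n G" "ball_system m G'" "ball_refines G G'"
  shows "meets_balls G' \<subseteq> meets_balls G"
proof
  fix A assume A: "A \<in> meets_balls G'"
  have "A \<inter> qball x e \<noteq> {}" if xe: "(x, e) \<in> G" for x e
  proof -
    obtain x' e' where x': "(x', e') \<in> G'" "d x x' + e' < e"
      using assms(3) xe unfolding ball_refines_def by fastforce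
    have "qball x' e' \<subseteq> qball x e"
    proof
      fix z assume "z \<in> qball x' e'"
      then show "z \<in> qball x e"
        using dist_triangle[of x x' z] x'(2) ball_systemD(1)[OF assms(1) xe]
          ball_systemD(1)[OF assms(2) x'(1)] unfolding quasi_metric_ball_def by auto
    qed
    moreover have "A \<inter> qball x' e' \<noteq> {}" using A x'(1) unfolding mem_meets_balls by auto
    ultimately show ?thesis by blast
  qed
  then show "A \<in> meets_balls G" using A unfolding mem_meets_balls by auto
qed

lemma ball_refinement_exists:
  assumes G: "ball_system n G" and A: "A \<in> meets_balls G"
  shows "\<exists>G'. ball_system m G' \<and> ball_refines G G' \<and> A \<in> meets_balls G'"
proof -
  have "\<exists>y. y \<in> A \<and> y \<in> qball (fst b) (snd b)" if "b \<in> G" for b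
    using A that unfolding mem_meets_balls by fastforce
  then obtain y where y: "\<And>b. b \<in> G \<Longrightarrow> y b \<in> A \<and> y b \<in> qball (fst b) (snd b)" by metis
  \<comment> \<open>Half of the room left around \<open>y b\<close> keeps the refinement
    strict.\<close>
  define r where "r b = min ((1/2) ^ m) ((snd b - d (fst b) (y b)) / 2)" for b
  have yb: "y b \<in> topspace X" "d (fst b) (y b) < snd b" if "b \<in> G" for b
    using y[OF that] unfolding quasi_metric_ball_def by auto
  have r: "0 < r b" "r b \<le> (1/2) ^ m" "d (fst b) (y b) + r b < snd b" if "b \<in> G" for b
    using yb(2)[OF that] unfolding r_def by (auto simp: min_def field_simps)
  define G' where "G' = (\<lambda>b. (y b, r b)) ` G"
  have "ball_system m G'"
    using G yb(1) r(1,2) unfolding ball_system_def G'_def by auto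
  moreover have "ball_refines G G'"
    using r(3) unfolding ball_refines_def G'_def by fastforce
  moreover have "y b \<in> A \<inter> qball (y b) (r b)" if "b \<in> G" for b
    using y[OF that] yb(1)[OF that] r(1)[OF that] dist_self unfolding quasi_metric_ball_def by simp
  then have "A \<in> meets_balls G'"
    using A unfolding mem_meets_balls G'_def by blast
  ultimately show ?thesis by blast
qed

lemma meets_balls_basis:
  assumes "openin (closeds_space X) \<U>" "A \<in> \<U>"
  shows "\<exists>G. ball_system m G \<and> A \<in> meets_balls G \<and> meets_balls G \<subseteq> \<U>"
proof -
  obtain F where F: "finite F" "\<forall>U\<in>F. openin X U" "A \<in> diamonds X F" "diamonds X F \<subseteq> \<U>"
    using assms unfolding openin_closeds_space by meson
  have "\<exists>x e. x \<in> A \<and> x \<in> topspace X \<and> 0 < e \<and> e \<le> (1/2) ^ m \<and> qball x e \<subseteq> U" if U: "U \<in> F" for U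
  proof -
    obtain x where x: "x \<in> A" "x \<in> U" using F(3) U unfolding diamonds_def by blast
    then obtain e where e: "e > 0" "qball x e \<subseteq> U" using F(2) U unfolding openin_iff by blast
    have "qball x (min e ((1/2) ^ m)) \<subseteq> U" using e(2) unfolding quasi_metric_ball_def by auto
    moreover have "x \<in> topspace X" using x(2) F(2) U openin_subset by blast
    ultimately show ?thesis using x(1) e(1)
      by (intro exI[of _ x] exI[of _ "min e ((1/2) ^ m)"]) auto
  qed
  then obtain x e where xe: "\<And>U. U \<in> F \<Longrightarrow> x U \<in> A \<and> x U \<in> topspace X \<and> 0 < e U \<and> e U \<le> (1/2) ^ m \<and> qball (x U) (e U) \<subseteq> U"
    by metis
  define G where "G = (\<lambda>U. (x U, e U)) ` F"
  have "ball_system m G" using F(1) xe unfolding ball_system_def G_def by auto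
  moreover have "x U \<in> A \<inter> qball (x U) (e U)" if "U \<in> F" for U
    using xe[OF that] dist_self unfolding quasi_metric_ball_def by simp
  then have "A \<in> meets_balls G"
    using F(3) unfolding mem_meets_balls G_def diamonds_def by blast
  moreover have "meets_balls G \<subseteq> diamonds X F"
  proof
    fix B assume B: "B \<in> meets_balls G"
    have "B \<inter> U \<noteq> {}" if "U \<in> F" for U
    proof -
      have "B \<inter> qball (x U) (e U) \<noteq> {}" using B that unfolding mem_meets_balls G_def by auto
      then show ?thesis using xe[OF that] by blast
    qed
    then show "B \<in> diamonds X F" using B unfolding mem_meets_balls diamonds_def by blast
  qed
  ultimately show ?thesis using F(4) by blast
qed

text \<open>The limit \<open>A\<close> consists of the points each of whose open neighbourhoods
  includes a ball of every sufficiently late \<open>G n\<close>. Following a ball through its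
  refinements yields such a point inside it, so \<open>A\<close> meets all the balls; conversely, a
  basic neighbourhood of \<open>A\<close> is implied by a late enough \<open>G n\<close>.\<close>

lemma ball_refinement_limit:
  assumes G: "\<And>n. ball_system n (G n)" and ref: "\<And>n. ball_refines (G n) (G (Suc n))"
  shows "\<exists>A. (\<forall>n. A \<in> meets_balls (G n)) \<and>
    (\<forall>\<V>. openin (closeds_space X) \<V> \<longrightarrow> A \<in> \<V> \<longrightarrow> (\<exists>n. meets_balls (G n) \<subseteq> \<V>))"
proof -
  define small where "small V \<longleftrightarrow> (\<exists>N. \<forall>n\<ge>N. \<exists>(x, e)\<in>G n. qball x e \<subseteq> V)" for V
  define A where "A = {l \<in> topspace X. \<forall>V. openin X V \<longrightarrow> l \<in> V \<longrightarrow> small V}"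
  have "openin X (topspace X - A)"
  proof (subst openin_subopen, intro ballI)
    fix l assume "l \<in> topspace X - A"
    then obtain V where V: "openin X V" "l \<in> V" "\<not> small V" unfolding A_def by blast
    then have "V \<subseteq> topspace X - A" using openin_subset[OF V(1)] unfolding A_def by blast
    then show "\<exists>T. openin X T \<and> l \<in> T \<and> T \<subseteq> topspace X - A" using V by blast
  qed
  then have cA: "closedin X A" unfolding closedin_def A_def by blast
  have "A \<inter> qball x e \<noteq> {}" if xe: "(x, e) \<in> G k" for k x e
  proof -
    \<comment> \<open>Dependent choice of a chain of balls; the clause for \<open>n = 0\<close> pins
      its start to the given ball.\<close>
    have "\<exists>b. \<forall>n. (b n \<in> G (k + n) \<and> (n = 0 \<longrightarrow> b n = (x, e))) \<and>
        d (fst (b n)) (fst (b (Suc n))) + snd (b (Suc n)) < snd (b n)"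
    proof (rule dependent_nat_choice)
      show "\<exists>b. b \<in> G (k + 0) \<and> (0 = (0::nat) \<longrightarrow> b = (x, e))" using xe by simp
      fix b n assume "b \<in> G (k + n) \<and> (n = 0 \<longrightarrow> b = (x, e))"
      then show "\<exists>c. (c \<in> G (k + Suc n) \<and> (Suc n = 0 \<longrightarrow> c = (x, e))) \<and> d (fst b) (fst c) + snd c < snd b"
        using ref[of "k + n"] unfolding ball_refines_def by fastforce
    qed
    then obtain b where b: "\<And>n. b n \<in> G (k + n)" "b 0 = (x, e)"
      "\<And>n. d (fst (b n)) (fst (b (Suc n))) + snd (b (Suc n)) < snd (b n)" by blast
    have bs: "fst (b n) \<in> topspace X" "0 < snd (b n)" "snd (b n) \<le> (1/2) ^ (k + n)" for n
      using ball_systemD[OF G, of "fst (b n)" "snd (b n)" "k + n"] b(1)[of n] by auto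
    have "(\<lambda>n. snd (b n)) \<longlonglongrightarrow> 0"
    proof (rule tendsto_sandwich[of "\<lambda>_. 0"])
      show "(\<lambda>n. (1/2) ^ (k + n) :: real) \<longlonglongrightarrow> 0"
        using LIMSEQ_ignore_initial_segment[OF LIMSEQ_power_zero[of "1/2 :: real"], of k]
        by (simp add: add.commute)
    qed (use bs(2,3) in \<open>auto intro!: always_eventually intro: less_imp_le\<close>)
    then obtain l where l: "l \<in> topspace X" "\<And>n. l \<in> qball (fst (b n)) (snd (b n))"
      "\<And>V. openin X V \<Longrightarrow> l \<in> V \<Longrightarrow> \<exists>N. \<forall>n\<ge>N. qball (fst (b n)) (snd (b n)) \<subseteq> V"
      using nested_qballs_limit[of "\<lambda>n. fst (b n)" "\<lambda>n. snd (b n)"] bs b(3) by blast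
    have "small V" if V: "openin X V" "l \<in> V" for V
    proof -
      obtain N where N: "\<forall>n\<ge>N. qball (fst (b n)) (snd (b n)) \<subseteq> V" using l(3)[OF V] by blast
      have "\<exists>(x, e)\<in>G n. qball x e \<subseteq> V" if "n \<ge> k + N" for n
      proof -
        have "b (n - k) \<in> G n" using b(1)[of "n - k"] that by simp
        moreover have "qball (fst (b (n - k))) (snd (b (n - k))) \<subseteq> V" using N that by simp
        ultimately show ?thesis by (intro bexI[of _ "b (n - k)"]) (auto simp: case_prod_beta)
      qed
      then show ?thesis unfolding small_def by blast
    qed
    then have "l \<in> A" using l(1) unfolding A_def by blast
    moreover have "l \<in> qball x e" using l(2)[of 0] b(2) by simp
    ultimately show ?thesis by blast
  qed
  then have "A \<in> meets_balls (G n)" for n using cA unfolding mem_meets_balls by blast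
  moreover have "\<exists>n. meets_balls (G n) \<subseteq> \<V>" if \<V>: "openin (closeds_space X) \<V>" "A \<in> \<V>" for \<V>
  proof -
    obtain F where F: "finite F" "\<forall>U\<in>F. openin X U" "A \<in> diamonds X F" "diamonds X F \<subseteq> \<V>"
      using \<V> unfolding openin_closeds_space by meson
    have "small U" if "U \<in> F" for U
      using F(2,3) that unfolding diamonds_def A_def by blast
    then have "\<forall>U\<in>F. \<exists>N. \<forall>n\<ge>N. \<exists>(x, e)\<in>G n. qball x e \<subseteq> U" unfolding small_def by blast
    then obtain N where N: "\<forall>U\<in>F. \<forall>n\<ge>N U. \<exists>(x, e)\<in>G n. qball x e \<subseteq> U" by metis
    define n where "n = Max (insert 0 (N ` F))"
    have "meets_balls (G n) \<subseteq> diamonds X F"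
    proof
      fix B assume B: "B \<in> meets_balls (G n)"
      have "B \<inter> U \<noteq> {}" if U: "U \<in> F" for U
      proof -
        have "N U \<le> n" using F(1) U unfolding n_def by simp
        then obtain x e where xe: "(x, e) \<in> G n" "qball x e \<subseteq> U" using N U by fastforce
        then have "B \<inter> qball x e \<noteq> {}" using B unfolding mem_meets_balls by auto
        then show ?thesis using xe(2) by blast
      qed
      then show "B \<in> diamonds X F" using B unfolding mem_meets_balls diamonds_def by blast
    qed
    then show ?thesis using F(4) by blast
  qed
  ultimately show ?thesis by blast
qed

text \<open>Reduces a Scott open neighbourhood of \<open>\<U>\<close> to the open neighbourhoods of
  one compact \<open>\<K> \<subseteq> \<U>\<close>, as continuity of \<open>gamma_map\<close>
  requires.\<close>

lemma closeds_space_consonant: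
  assumes H: "Scott_open_in {\<U>. openin (closeds_space X) \<U>} H" and \<U>: "\<U> \<in> H"
  shows "\<exists>\<K>. compactin (closeds_space X) \<K> \<and> \<K> \<subseteq> \<U> \<and>
    (\<forall>\<V>. openin (closeds_space X) \<V> \<longrightarrow> \<K> \<subseteq> \<V> \<longrightarrow> \<V> \<in> H)"
proof -
  let ?A = "closeds_space X"
  have op\<U>: "openin ?A \<U>" using Scott_open_inD(1)[OF H] \<U> by blast
  define good where "good n J \<longleftrightarrow> finite J \<and> (\<forall>G\<in>J. ball_system n G) \<and>
    \<Union>(meets_balls ` J) \<in> H \<and> \<Union>(meets_balls ` J) \<subseteq> \<U>" for n J
  have select: "\<exists>J. good n J \<and> J \<subseteq> \<G>"
    if \<G>: "\<forall>G\<in>\<G>. ball_system n G" "\<Union>(meets_balls ` \<G>) \<in> H" "\<Union>(meets_balls ` \<G>) \<subseteq> \<U>" for n \<G>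
  proof -
    have "\<And>U. U \<in> meets_balls ` \<G> \<Longrightarrow> openin ?A U" using \<G>(1) openin_meets_balls by blast
    from Scott_open_in_finite_subfamily[OF H this \<G>(2)]
    obtain C where C: "finite C" "C \<subseteq> meets_balls ` \<G>" "\<Union>C \<in> H" by blast
    then obtain J where J: "J \<subseteq> \<G>" "finite J" "C = meets_balls ` J" by (meson finite_subset_image)
    have "\<Union>(meets_balls ` J) \<subseteq> \<U>" using J(1) \<G>(3) by blast
    then have "good n J" using J C(3) \<G>(1) unfolding good_def by blast
    then show ?thesis using J(1) by blast
  qed
  have "\<exists>J. \<forall>n. good n (J n) \<and> (\<forall>G'\<in>J (Suc n). \<exists>G\<in>J n. ball_refines G G')"
  proof (rule dependent_nat_choice)
    define \<G> where "\<G> = {G. ball_system 0 G \<and> meets_balls G \<subseteq> \<U>}"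
    have "\<Union>(meets_balls ` \<G>) = \<U>"
    proof
      show "\<Union>(meets_balls ` \<G>) \<subseteq> \<U>" unfolding \<G>_def by blast
      show "\<U> \<subseteq> \<Union>(meets_balls ` \<G>)"
      proof
        fix A assume "A \<in> \<U>"
        from meets_balls_basis[OF op\<U> this, of 0] show "A \<in> \<Union>(meets_balls ` \<G>)" unfolding \<G>_def by blast
      qed
    qed
    then show "\<exists>J. good 0 J" using select[of \<G> 0] \<U> unfolding \<G>_def by auto
  next
    fix J n assume J: "good n J"
    define \<G> where "\<G> = {G'. ball_system (Suc n) G' \<and> (\<exists>G\<in>J. ball_refines G G')}"
    \<comment> \<open>Passing to all refinements with smaller radii loses no closed set, so the
      union stays in \<open>H\<close> and \<open>select\<close> again gives a finite level.\<close>
    have "\<Union>(meets_balls ` \<G>) = \<Union>(meets_balls ` J)"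
    proof
      show "\<Union>(meets_balls ` \<G>) \<subseteq> \<Union>(meets_balls ` J)"
      proof
        fix A assume "A \<in> \<Union>(meets_balls ` \<G>)"
        then obtain G G' where GG: "ball_system (Suc n) G'" "G \<in> J" "ball_refines G G'" "A \<in> meets_balls G'"
          unfolding \<G>_def by blast
        have "ball_system n G" using J GG(2) unfolding good_def by blast
        from meets_balls_antimono[OF this GG(1,3)] GG(2,4) show "A \<in> \<Union>(meets_balls ` J)" by blast
      qed
      show "\<Union>(meets_balls ` J) \<subseteq> \<Union>(meets_balls ` \<G>)"
      proof
        fix A assume "A \<in> \<Union>(meets_balls ` J)"
        then obtain G where G: "G \<in> J" "A \<in> meets_balls G" by blast
        have "ball_system n G" using J G(1) unfolding good_def by blast
        from ball_refinement_exists[OF this G(2), of "Suc n"] G(1)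
        show "A \<in> \<Union>(meets_balls ` \<G>)" unfolding \<G>_def by blast
      qed
    qed
    then obtain J' where "good (Suc n) J'" "J' \<subseteq> \<G>"
      using select[of \<G> "Suc n"] J unfolding \<G>_def good_def by auto
    then show "\<exists>J'. good (Suc n) J' \<and> (\<forall>G'\<in>J'. \<exists>G\<in>J. ball_refines G G')" unfolding \<G>_def by blast
  qed
  then obtain J where J: "\<And>n. good n (J n)"
    and ref: "\<And>n G'. G' \<in> J (Suc n) \<Longrightarrow> \<exists>G\<in>J n. ball_refines G G'" by blast
  have finJ: "finite (J n)" and JH: "\<Union>(meets_balls ` J n) \<in> H" and J\<U>: "\<Union>(meets_balls ` J n) \<subseteq> \<U>"
    and Jball: "\<And>G. G \<in> J n \<Longrightarrow> ball_system n G" for n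
    using J[of n] unfolding good_def by auto
  define \<K> where "\<K> = (\<Inter>n. \<Union>(meets_balls ` J n))"
  \<comment> \<open>Any open cover of \<open>\<K>\<close> finitely covers a whole level, not only
    \<open>\<K>\<close>. Otherwise each level has a system that is not finitely covered; its
    ancestors are not either, so Koenig's lemma gives a branch. The limit of the branch is in
    \<open>\<K>\<close>, hence in one member of the cover, which then includes a whole
    \<open>meets_balls (G n)\<close>.\<close>
  have key: "\<exists>C' n. finite C' \<and> C' \<subseteq> C \<and> \<Union>(meets_balls ` J n) \<subseteq> \<Union>C'"
    if C: "\<And>\<V>. \<V> \<in> C \<Longrightarrow> openin ?A \<V>" "\<K> \<subseteq> \<Union>C" for C
  proof (rule ccontr)
    assume no: "\<not> ?thesis"
    define bad where "bad G \<longleftrightarrow> \<not> (\<exists>C'. finite C' \<and> C' \<subseteq> C \<and> meets_balls G \<subseteq> \<Union>C')" for G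
    have "\<exists>G. \<forall>n. G n \<in> {G \<in> J n. bad G} \<and> ball_refines (G n) (G (Suc n))"
    proof (rule infinite_path_in_finite_levels)
      fix n
      show "finite {G \<in> J n. bad G}" using finJ by simp
      show "{G \<in> J n. bad G} \<noteq> {}"
      proof
        assume "{G \<in> J n. bad G} = {}"
        then have "\<forall>G\<in>J n. \<exists>C'. finite C' \<and> C' \<subseteq> C \<and> meets_balls G \<subseteq> \<Union>C'"
          unfolding bad_def by blast
        from bchoice[OF this] obtain c where
          c: "\<forall>G\<in>J n. finite (c G) \<and> c G \<subseteq> C \<and> meets_balls G \<subseteq> \<Union>(c G)" by blast
        have "finite (\<Union>(c ` J n))" using finJ c by blast
        moreover have "\<Union>(c ` J n) \<subseteq> C" using c by blast
        moreover have "\<Union>(meets_balls ` J n) \<subseteq> \<Union>(\<Union>(c ` J n))"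
        proof
          fix A assume "A \<in> \<Union>(meets_balls ` J n)"
          then obtain G where G: "G \<in> J n" "A \<in> meets_balls G" by blast
          then have "A \<in> \<Union>(c G)" using bspec[OF c G(1)] by (meson subsetD)
          then show "A \<in> \<Union>(\<Union>(c ` J n))" using G(1) by blast
        qed
        ultimately show False using no by blast
      qed
      fix G' assume "G' \<in> {G \<in> J (Suc n). bad G}"
      then have G': "G' \<in> J (Suc n)" "bad G'" by auto
      then obtain G where G: "G \<in> J n" "ball_refines G G'" using ref by blast
      then have "meets_balls G' \<subseteq> meets_balls G"
        using meets_balls_antimono Jball G'(1) by blast
      then have "bad G" using G'(2) unfolding bad_def by (meson order_trans)
      then show "\<exists>G\<in>{G \<in> J n. bad G}. ball_refines G G'" using G by blast
    qed
    then obtain G where G: "\<And>n. G n \<in> J n" "\<And>n. bad (G n)" "\<And>n. ball_refines (G n) (G (Suc n))"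
      by blast
    obtain A where A: "\<And>n. A \<in> meets_balls (G n)"
      "\<And>\<V>. openin ?A \<V> \<Longrightarrow> A \<in> \<V> \<Longrightarrow> \<exists>n. meets_balls (G n) \<subseteq> \<V>"
      using ball_refinement_limit[of G] Jball G(1,3) by blast
    have "A \<in> \<K>" unfolding \<K>_def using A(1) G(1) by blast
    then obtain \<V> where \<V>: "\<V> \<in> C" "A \<in> \<V>" using C(2) by blast
    obtain n where "meets_balls (G n) \<subseteq> \<V>" using A(2)[OF C(1)[OF \<V>(1)] \<V>(2)] by blast
    then have "finite {\<V>} \<and> {\<V>} \<subseteq> C \<and> meets_balls (G n) \<subseteq> \<Union>{\<V>}" using \<V>(1) by simp
    then show False using G(2)[of n] unfolding bad_def by blast
  qed
  have \<K>\<U>: "\<K> \<subseteq> \<U>" using J\<U>[of 0] unfolding \<K>_def by blast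
  moreover have "compactin ?A \<K>"
    unfolding compactin_def
  proof (intro conjI allI impI)
    show "\<K> \<subseteq> topspace ?A" using \<K>\<U> openin_subset[OF op\<U>] by blast
    fix C assume C: "Ball C (openin ?A) \<and> \<K> \<subseteq> \<Union>C"
    then obtain C' n where "finite C'" "C' \<subseteq> C" "\<Union>(meets_balls ` J n) \<subseteq> \<Union>C'" using key[of C] by blast
    moreover have "\<K> \<subseteq> \<Union>(meets_balls ` J n)" unfolding \<K>_def by blast
    ultimately show "\<exists>C'. finite C' \<and> C' \<subseteq> C \<and> \<K> \<subseteq> \<Union>C'" by (meson order_trans)
  qed
  moreover have "\<V> \<in> H" if \<V>: "openin ?A \<V>" "\<K> \<subseteq> \<V>" for \<V>
  proof -
    \<comment> \<open>With the one-element cover, a whole level lies inside \<open>\<V>\<close>; its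
      union is in \<open>H\<close>, which is upward closed.\<close>
    obtain C' n where "C' \<subseteq> {\<V>}" "\<Union>(meets_balls ` J n) \<subseteq> \<Union>C'" using key[of "{\<V>}"] \<V> by auto
    then have "\<Union>(meets_balls ` J n) \<subseteq> \<V>" by blast
    then show ?thesis using Scott_open_inD(2)[OF H JH[of n]] \<V>(1) by blast
  qed
  ultimately show ?thesis by blast
qed

end

section \<open>The homeomorphism\<close>

lemma quasi_Polish_closeds_space_consonant:
  assumes "quasi_Polish X" "Scott_open_in {\<U>. openin (closeds_space X) \<U>} H" "\<U> \<in> H"
  shows "\<exists>\<K>. compactin (closeds_space X) \<K> \<and> \<K> \<subseteq> \<U> \<and>
    (\<forall>\<V>. openin (closeds_space X) \<V> \<longrightarrow> \<K> \<subseteq> \<V> \<longrightarrow> \<V> \<in> H)"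
proof -
  obtain d where "Smyth_quasi_metric X d"
    using assms(1) unfolding quasi_Polish_def Smyth_quasi_metric_def by blast
  then show ?thesis using Smyth_quasi_metric.closeds_space_consonant assms(2,3) by blast
qed

lemma continuous_map_gamma_map:
  assumes X: "quasi_Polish X"
  shows "continuous_map (compacts_space (opens_space X)) (opens_space (closeds_space X)) (gamma_map X)"
  unfolding continuous_map
proof (intro conjI allI impI)
  let ?A = "closeds_space X" and ?K = "compacts_space (opens_space X)"
  have \<gamma>: "openin ?A (gamma_map X \<KK>)" if "\<KK> \<in> compact_saturated (opens_space X)" for \<KK>
    using gamma_map_openin[of X \<KK>] X that unfolding quasi_Polish_def compact_saturated_def by blast
  then show "gamma_map X ` topspace ?K \<subseteq> topspace (opens_space ?A)"
    unfolding topspace_compacts_space by (auto simp: opens_space_def)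
  fix H assume "openin (opens_space ?A) H"
  then have H: "Scott_open_in {\<U>. openin ?A \<U>} H" unfolding opens_space_def openin_Scott_topology .
  show "openin ?K {\<KK> \<in> topspace ?K. gamma_map X \<KK> \<in> H}"
    unfolding openin_compacts_space
  proof (intro ballI)
    fix \<KK> assume "\<KK> \<in> {\<KK> \<in> topspace ?K. gamma_map X \<KK> \<in> H}"
    then have \<KK>: "\<KK> \<in> compact_saturated (opens_space X)" "gamma_map X \<KK> \<in> H"
      unfolding topspace_compacts_space by auto
    obtain \<K> where \<K>: "compactin ?A \<K>" "\<K> \<subseteq> gamma_map X \<KK>"
      "\<And>\<V>. openin ?A \<V> \<Longrightarrow> \<K> \<subseteq> \<V> \<Longrightarrow> \<V> \<in> H"
      using quasi_Polish_closeds_space_consonant[OF X H \<KK>(2)] by blast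
    have closed: "closedin X A" if "A \<in> \<K>" for A using \<K>(2) that unfolding gamma_map_def by blast
    \<comment> \<open>This is \<open>delta_map X \<K>\<close>, with compact \<open>\<K>\<close> in
      place of an open set; compactness makes it Scott open. For any \<open>L \<subseteq> W\<close>,
      \<open>gamma_map X L\<close> is an open set including \<open>\<K>\<close>, hence in
      \<open>H\<close>.\<close>
    define W where "W = {U. openin X U \<and> \<K> \<subseteq> diamond X U}"
    have "openin (opens_space X) W"
      unfolding opens_space_def openin_Scott_topology
    proof (rule Scott_open_in_opensI)
      fix U V assume "U \<in> W" "openin X V" "U \<subseteq> V"
      then show "V \<in> W" unfolding W_def diamond_def by blast
    next
      fix D assume D: "\<And>U. U \<in> D \<Longrightarrow> openin X U" "directed_set D" "\<Union>D \<in> W"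
      have "\<K> \<subseteq> \<Union>(diamond X ` D)" using D(3) unfolding W_def diamond_def by blast
      moreover have "\<And>\<V>. \<V> \<in> diamond X ` D \<Longrightarrow> openin ?A \<V>"
        using D(1) openin_closeds_space_diamond by blast
      ultimately obtain \<F> where \<F>: "finite \<F>" "\<F> \<subseteq> diamond X ` D" "\<K> \<subseteq> \<Union>\<F>"
        using compactinD[OF \<K>(1), of "diamond X ` D"] by blast
      then obtain E where E: "E \<subseteq> D" "finite E" "\<F> = diamond X ` E" by (meson finite_subset_image)
      obtain Z where Z: "Z \<in> D" "\<forall>U\<in>E. U \<subseteq> Z"
        using directed_set_finite_upper_bound[OF D(2) E(2,1)] by blast
      have "\<K> \<subseteq> diamond X Z"
      proof
        fix A assume "A \<in> \<K>"
        then obtain U where "U \<in> E" "A \<in> diamond X U" using \<F>(3) E(3) by blast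
        then show "A \<in> diamond X Z" using Z(2) unfolding diamond_def by blast
      qed
      then show "\<exists>U\<in>D. U \<in> W" using Z(1) D(1) unfolding W_def by blast
    qed (simp add: W_def)
    moreover have "\<KK> \<in> box_set (opens_space X) W"
    proof -
      have "openin X U" if "U \<in> \<KK>" for U
        using \<KK>(1) that compactin_subset_topspace[of "opens_space X" \<KK>]
        unfolding compact_saturated_def opens_space_def by auto
      then have "\<KK> \<subseteq> W" using \<K>(2) unfolding W_def gamma_map_def by blast
      then show ?thesis using \<KK>(1) unfolding box_set_def by blast
    qed
    moreover have "box_set (opens_space X) W \<subseteq> {\<KK> \<in> topspace ?K. gamma_map X \<KK> \<in> H}"
    proof
      fix L assume "L \<in> box_set (opens_space X) W"
      then have L: "L \<in> compact_saturated (opens_space X)" "L \<subseteq> W" unfolding box_set_def by auto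
      have "\<K> \<subseteq> gamma_map X L" using L(2) closed unfolding W_def gamma_map_def by blast
      then have "gamma_map X L \<in> H" using \<K>(3) \<gamma>[OF L(1)] by blast
      then show "L \<in> {\<KK> \<in> topspace ?K. gamma_map X \<KK> \<in> H}"
        using L(1) unfolding topspace_compacts_space by simp
    qed
    ultimately show "\<exists>U. openin (opens_space X) U \<and> \<KK> \<in> box_set (opens_space X) U \<and>
        box_set (opens_space X) U \<subseteq> {\<KK> \<in> topspace ?K. gamma_map X \<KK> \<in> H}" by blast
  qed
qed

theorem theorem9p5:
  fixes X :: "'a topology"
  assumes "quasi_Polish X"
  shows "homeomorphic_maps (compacts_space (opens_space X)) (opens_space (closeds_space X))
           (gamma_map X) (delta_map X)"
  unfolding homeomorphic_maps_def
proof (intro conjI ballI)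
  show "continuous_map (compacts_space (opens_space X)) (opens_space (closeds_space X)) (gamma_map X)"
    by (rule continuous_map_gamma_map[OF assms])
  show "continuous_map (opens_space (closeds_space X)) (compacts_space (opens_space X)) (delta_map X)"
    by (rule continuous_map_delta_map)
  show "delta_map X (gamma_map X \<KK>) = \<KK>" if "\<KK> \<in> topspace (compacts_space (opens_space X))" for \<KK>
    using that delta_gamma unfolding topspace_compacts_space by blast
  show "gamma_map X (delta_map X \<U>) = \<U>" if "\<U> \<in> topspace (opens_space (closeds_space X))" for \<U>
    using that gamma_delta by (auto simp: opens_space_def)
qed

end
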